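(* Let $U,V$ be potentials and $\sigma_N\ge0$ be such that, for each $N$, the system $$dX^i_t=\sqrt{2\sigma_N}\,dB^i_t-U'(X^i_t)\,dt-\frac1N\sum_{j\ne i}V'(X^i_t-X^j_t)\,dt,\qquad i=1,\dots,N,\quad(\ast)$$ has a strong solution $(X^1_t,\dots,X^N_t)_{t\ge0}$ (with the particles remaining ordered). For each $N$ fix an initial condition, and let $\mu^N_t=\frac1N\sum_{i=1}^N\delta_{X^i_t}$. Assume: (1) [Weak propagation of chaos] $\mu^N_0$ converges in $L^2$ Wasserstein distance (in probability) to a deterministic measure $\bar\rho_0$ and, for all $t\ge0$, $\mu^N_t$ converges weakly (in probability) as $N\to\infty$ to a deterministic probability measure $\bar\rho_t$. (2) [Bounded moments] There is $C_0\ge0$ such that for all $N$ and all $t\ge0$, $\mathbb E\big(\frac1N\sum_{i=1}^N|X^i_t|^4\big)\le C_0$. (3) [Long time convergence] There is $\lambda>0$ (independent of $N$) such that for all $N$, if $\rho^{1,N}_t$ and $\rho^{2,N}_t$ are the laws of the $N$-particle system at time $t$ with respective initial laws $\rho^{1,N}_0$ and $\rho^{2,N}_0$, then $\mathcal W_2(\rho^{1,N}_t,\rho^{2,N}_t)\le e^{-\lambda t}\mathcal W_2(\rho^{1,N}_0,\rho^{2,N}_0)$ for all $t\ge0$. (4) [Continuity in 0] For every $\epsilon>0$ there is $\delta>0$ such that for all $0\le t<\delta$ and all $N$, $\mathbb E\big(\frac1N\sum_{i=1}^N|X^i_t-X^i_0|^2\big)\le\epsilon$. Then $$\forall\epsilon>0,\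 \exists N\ge0,\ \forall t\ge0,\ \forall n\ge N,\qquad \mathbb E\big(\mathcal W_2(\mu^n_t,\bar\rho_t)\big)<\epsilon .$$
   Context: The $B^i$ are independent one-dimensional Brownian motions, independent of the initial condition. Configurations take values in (the closure of) $\mathcal O_N=\{(x_1,\dots,x_N)\in\mathbb R^N:\ x_1<\dots<x_N\}$. $\mathcal W_2$ is the $L^2$ Wasserstein distance (on probability measures on $\mathbb R$, or on $\mathbb R^N$ with the Euclidean norm). *)

theory Defs
  imports "HOL-Probability.Probability"
begin

section \<open>Wasserstein distance\<close>

definition couplings :: "'b measure \<Rightarrow> 'b measure \<Rightarrow> ('b \<times> 'b) measure set" where
  "couplings \<mu> \<nu> = {\<pi>. prob_space \<pi> \<and> sets \<pi> = sets (\<mu> \<Otimes>\<^sub>M \<nu>) \<and>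
     distr \<pi> \<mu> fst = \<mu> \<and> distr \<pi> \<nu> snd = \<nu>}"

definition ennreal_sqrt :: "ennreal \<Rightarrow> ennreal" where
  "ennreal_sqrt x = (if x = \<top> then \<top> else ennreal (sqrt (enn2real x)))"

text \<open>
  The ground distance \<open>d\<close> is an explicit argument. The value is in \<open>ennreal\<close>, since the
  distance is infinite for some pairs of probability measures without second moments.
\<close>

definition wasserstein2 :: "('b \<Rightarrow> 'b \<Rightarrow> real) \<Rightarrow> 'b measure \<Rightarrow> 'b measure \<Rightarrow> ennreal" where
  "wasserstein2 d \<mu> \<nu> =
     (INF \<pi> \<in> couplings \<mu> \<nu>. ennreal_sqrt (\<integral>\<^sup>+ (x, y). ennreal ((d x y)\<^sup>2) \<partial>\<pi>))"

abbreviation W2_line :: "real measure \<Rightarrow> real measure \<Rightarrow> ennreal" where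
  "W2_line \<equiv> wasserstein2 dist"

text \<open>
  Points of \<open>\<real>\<^sup>N\<close> are functions on \<open>nat\<close>, of which only the coordinates in
  \<open>{..<N}\<close> matter; measures on \<open>\<real>\<^sup>N\<close> live on the product space \<open>PiM {..<N} (\<lambda>_. borel)\<close>.
\<close>

abbreviation W2_config :: "nat \<Rightarrow> (nat \<Rightarrow> real) measure \<Rightarrow> (nat \<Rightarrow> real) measure \<Rightarrow> ennreal" where
  "W2_config N \<equiv> wasserstein2 (\<lambda>x y. L2_set (\<lambda>i. x i - y i) {..<N})"


section \<open>Convergence in probability to a deterministic limit\<close>

text \<open>\<open>D N\<close> is the random distance between the \<open>N\<close>-th random object and the limit.\<close>

definition vanishes_in_prob :: "(nat \<Rightarrow> 'a measure) \<Rightarrow> (nat \<Rightarrow> 'a \<Rightarrow> ennreal) \<Rightarrow> bool" where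
  "vanishes_in_prob M D \<longleftrightarrow>
     (\<forall>\<epsilon>>0. (\<lambda>N. measure (M N) {\<omega> \<in> space (M N). ennreal \<epsilon> < D N \<omega>}) \<longlonglongrightarrow> 0)"

definition W2_converges_in_prob ::
  "(nat \<Rightarrow> 'a measure) \<Rightarrow> (nat \<Rightarrow> 'a \<Rightarrow> real measure) \<Rightarrow> real measure \<Rightarrow> bool" where
  "W2_converges_in_prob M \<mu> \<nu> \<longleftrightarrow> vanishes_in_prob M (\<lambda>N \<omega>. W2_line (\<mu> N \<omega>) \<nu>)"

definition weakly_converges_in_prob ::
  "(nat \<Rightarrow> 'a measure) \<Rightarrow> (nat \<Rightarrow> 'a \<Rightarrow> real measure) \<Rightarrow> real measure \<Rightarrow> bool" where
  "weakly_converges_in_prob M \<mu> \<nu> \<longleftrightarrow>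
     (\<forall>f. continuous_on UNIV f \<and> bounded (range f) \<longrightarrow>
        vanishes_in_prob M (\<lambda>N \<omega>. ennreal \<bar>(\<integral>x. f x \<partial>\<mu> N \<omega>) - (\<integral>x. f x \<partial>\<nu>)\<bar>))"


section \<open>Brownian motion\<close>

definition brownian_motion :: "'a measure \<Rightarrow> (real \<Rightarrow> 'a \<Rightarrow> real) \<Rightarrow> bool" where
  "brownian_motion M W \<longleftrightarrow>
     (\<forall>t\<ge>0. W t \<in> borel_measurable M) \<and>
     (AE \<omega> in M. W 0 \<omega> = 0) \<and>
     (AE \<omega> in M. continuous_on {0..} (\<lambda>t. W t \<omega>)) \<and>
     (\<forall>(n::nat) (t::nat \<Rightarrow> real). 0 \<le> t 0 \<and> mono t \<longrightarrow>
        prob_space.indep_vars M (\<lambda>_. borel) (\<lambda>k \<omega>. W (t (Suc k)) \<omega> - W (t k) \<omega>) {..<n}) \<and>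
     (\<forall>s t. 0 \<le> s \<and> s < t \<longrightarrow>
        distributed M lborel (\<lambda>\<omega>. W t \<omega> - W s \<omega>) (\<lambda>x. ennreal (normal_density 0 (sqrt (t - s)) x)))"

definition history :: "'a measure \<Rightarrow> nat \<Rightarrow> (nat \<Rightarrow> real \<Rightarrow> 'a \<Rightarrow> real) \<Rightarrow> real set \<Rightarrow> 'a measure" where
  "history M N B T =
     vimage_algebra (space M) (\<lambda>\<omega>. \<lambda>(i, s)\<in>{..<N} \<times> T. B i s \<omega>) (PiM ({..<N} \<times> T) (\<lambda>_. borel))"

text \<open>
  \<open>F0\<close> is the initial sigma-algebra, with respect to which the initial condition is
  measurable; its independence of the driving noise is the last conjunct.
\<close>

definition driving_noise ::
  "'a measure \<Rightarrow> 'a measure \<Rightarrow> nat \<Rightarrow> (nat \<Rightarrow> real \<Rightarrow> 'a \<Rightarrow> real) \<Rightarrow> bool" where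
  "driving_noise M F0 N B \<longleftrightarrow>
     (\<forall>i<N. brownian_motion M (B i)) \<and>
     prob_space.indep_vars M (\<lambda>_. PiM {0..} (\<lambda>_. borel)) (\<lambda>i \<omega>. \<lambda>s\<in>{0..}. B i s \<omega>) {..<N} \<and>
     prob_space.indep_set M (sets F0) (sets (history M N B {0..}))"

definition noise_filtration ::
  "'a measure \<Rightarrow> 'a measure \<Rightarrow> nat \<Rightarrow> (nat \<Rightarrow> real \<Rightarrow> 'a \<Rightarrow> real) \<Rightarrow> real \<Rightarrow> 'a measure" where
  "noise_filtration M F0 N B t =
     sigma (space M) (sets F0 \<union> sets (history M N B {0..t}) \<union> null_sets M)"


section \<open>The particle system\<close>

text \<open>Particles are numbered from \<open>0\<close> to \<open>N - 1\<close>.\<close>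

definition drift :: "(real \<Rightarrow> real) \<Rightarrow> (real \<Rightarrow> real) \<Rightarrow> nat \<Rightarrow> (nat \<Rightarrow> real) \<Rightarrow> nat \<Rightarrow> real" where
  "drift U V N x i = - deriv U (x i) - (1 / real N) * (\<Sum>j\<in>{..<N} - {i}. deriv V (x i - x j))"

text \<open>
  The noise is additive, so the equation is stated in integrated form without a stochastic
  integral. The interaction potential may be singular at the origin and particles may touch,
  so the solution must avoid the points where \<open>V'\<close> is undefined at almost every
  time, and the drift must be integrable along the trajectory.
  Adaptedness to \<^const>\<open>noise_filtration\<close> makes the solution strong. The choice
  \<open>F0 = \<sigma>(X\<^sub>0)\<close> gives the usual notion; general \<open>F0\<close> is allowed so that a solution restarted
  at a time \<open>s\<close>, with the past up to \<open>s\<close> as initial sigma-algebra and with noise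
  \<open>B\<^bsub>s + t\<^esub> - B\<^sub>s\<close>, is again a solution.
\<close>

definition strong_solution ::
  "'a measure \<Rightarrow> 'a measure \<Rightarrow> nat \<Rightarrow> real \<Rightarrow> (real \<Rightarrow> real) \<Rightarrow> (real \<Rightarrow> real) \<Rightarrow>
   (nat \<Rightarrow> real \<Rightarrow> 'a \<Rightarrow> real) \<Rightarrow> (nat \<Rightarrow> real \<Rightarrow> 'a \<Rightarrow> real) \<Rightarrow> bool" where
  "strong_solution M F0 N \<sigma> U V B X \<longleftrightarrow>
     prob_space M \<and> subalgebra M F0 \<and> driving_noise M F0 N B \<and>
     (\<forall>i<N. X i 0 \<in> borel_measurable F0) \<and>
     (\<forall>i<N. \<forall>t\<ge>0. X i t \<in> borel_measurable (noise_filtration M F0 N B t)) \<and>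
     (AE \<omega> in M.
        (\<forall>i<N. continuous_on {0..} (\<lambda>t. X i t \<omega>)) \<and>
        (\<forall>t\<ge>0. mono_on {..<N} (\<lambda>i. X i t \<omega>)) \<and>
        (\<forall>i<N. \<forall>j<N. i \<noteq> j \<longrightarrow>
           (AE s in lborel. 0 \<le> s \<longrightarrow> V differentiable (at (X i s \<omega> - X j s \<omega>)))) \<and>
        (\<forall>i<N. \<forall>t\<ge>0.
           (\<lambda>s. drift U V N (\<lambda>j. X j s \<omega>) i) absolutely_integrable_on {0..t} \<and>
           X i t \<omega> = X i 0 \<omega> + sqrt (2 * \<sigma>) * B i t \<omega>
                      + integral {0..t} (\<lambda>s. drift U V N (\<lambda>j. X j s \<omega>) i)))"

definition config_law ::
  "'a measure \<Rightarrow> nat \<Rightarrow> (nat \<Rightarrow> real \<Rightarrow> 'a \<Rightarrow> real) \<Rightarrow> real \<Rightarrow> (nat \<Rightarrow> real) measure" where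
  "config_law M N X t = distr M (PiM {..<N} (\<lambda>_. borel)) (\<lambda>\<omega>. \<lambda>i\<in>{..<N}. X i t \<omega>)"

definition empirical_measure :: "nat \<Rightarrow> (nat \<Rightarrow> real) \<Rightarrow> real measure" where
  "empirical_measure N x = distr (uniform_count_measure {..<N}) borel x"

end

theory Submission
  imports Defs
begin

text \<open>
  Restarting the system at time \<open>h\<close> gives again a strong solution, with the past up to \<open>h\<close> as initial
  sigma-algebra. Hence the contraction compares the laws at times \<open>h + t\<close> and \<open>t\<close>, and together with
  continuity at \<open>0\<close> and the moment bound it yields, for every accuracy, finitely many times such that
  each law is close to the law at one of them, uniformly in the number of particles. This reduces
  the claim to a fixed time.

  The gluing of couplings is avoided by replacing \<open>W2\<close> on the line by the \<open>L\<^sup>2\<close> distance of quantile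
  functions, which dominates it and trivially satisfies a triangle inequality. A quantile function of the
  empirical measure of an ordered configuration is the step function \<open>u \<mapsto> x (nat \<lfloor>n u\<rfloor>)\<close>. At
  a fixed time weak convergence gives convergence in probability of these at almost every \<open>u\<close>, and
  the fourth moments give uniform integrability.
\<close>

section \<open>Restarting the particle system\<close>

text \<open>Weak convergence is given at each time separately, with a rate that may depend on
  \<open>t\<close>, and nothing is assumed on how \<open>\<rho> t\<close> varies with
  \<open>t\<close>. Both gaps are filled by the particles: the laws at times \<open>t\<close> and
  \<open>s\<close> are compared uniformly in \<open>n\<close>, and a sufficiently large auxiliary
  number of particles transfers this closeness to \<open>\<rho> t\<close> and
  \<open>\<rho> s\<close>. The rate at \<open>t\<close> only decides how large that auxiliary number
  is, and the resulting bound does not contain it.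

  Two scales meet. \<open>W2_config\<close> uses the unnormalised Euclidean norm, while moments,
  continuity at 0 and the cost on the line are averages over particles. Hence thresholds have the
  form \<open>sqrt (real n * c)\<close>, and \<open>n\<close> cancels because the contraction is
  linear in the initial distance.

  The contraction speaks of strong solutions only. To start it from the law at time
  \<open>h\<close>, the shifted process must itself be a strong solution, including independence of
  its noise from everything that happened up to \<open>h\<close>; this is where the properties of
  Brownian motion enter.\<close>

lemma (in prob_space) indep_var_PiM_finite_subsets:
  assumes X: "\<And>t. t \<in> I \<Longrightarrow> X t \<in> measurable M (S t)"
    and Y: "\<And>t. t \<in> L \<Longrightarrow> Y t \<in> measurable M (T t)"
    and fin: "\<And>J K. finite J \<Longrightarrow> J \<subseteq> I \<Longrightarrow> finite K \<Longrightarrow> K \<subseteq> L \<Longrightarrow>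
      indep_var (PiM J S) (\<lambda>\<omega>. \<lambda>t\<in>J. X t \<omega>) (PiM K T) (\<lambda>\<omega>. \<lambda>t\<in>K. Y t \<omega>)"
  shows "indep_var (PiM I S) (\<lambda>\<omega>. \<lambda>t\<in>I. X t \<omega>) (PiM L T) (\<lambda>\<omega>. \<lambda>t\<in>L. Y t \<omega>)"
proof -
  let ?X = "\<lambda>\<omega>. \<lambda>t\<in>I. X t \<omega>" and ?Y = "\<lambda>\<omega>. \<lambda>t\<in>L. Y t \<omega>"
  have mX: "?X \<in> measurable M (PiM I S)" and mY: "?Y \<in> measurable M (PiM L T)"
    using X Y by (auto intro!: measurable_restrict)
  have eqX: "{?X -` A \<inter> space M |A. A \<in> sets (PiM I S)}
      = sigma_sets (space M) {?X -` A \<inter> space M |A. A \<in> prod_algebra I S}"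
    unfolding sets_PiM using measurable_space[OF mX]
    by (intro sigma_sets_vimage_commute) (auto simp: space_PiM)
  have eqY: "{?Y -` A \<inter> space M |A. A \<in> sets (PiM L T)}
      = sigma_sets (space M) {?Y -` A \<inter> space M |A. A \<in> prod_algebra L T}"
    unfolding sets_PiM using measurable_space[OF mY]
    by (intro sigma_sets_vimage_commute) (auto simp: space_PiM)
  have stable: "Int_stable {f -` A \<inter> space M |A. A \<in> prod_algebra I' S'}"
    for f :: "'a \<Rightarrow> 'i \<Rightarrow> 'j" and I' S'
  proof (rule Int_stableI)
    fix a b assume "a \<in> {f -` A \<inter> space M |A. A \<in> prod_algebra I' S'}"
      "b \<in> {f -` A \<inter> space M |A. A \<in> prod_algebra I' S'}"
    then obtain A B where "a = f -` A \<inter> space M" "b = f -` B \<inter> space M"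
      "A \<in> prod_algebra I' S'" "B \<in> prod_algebra I' S'" by auto
    then show "a \<inter> b \<in> {f -` A \<inter> space M |A. A \<in> prod_algebra I' S'}"
      using Int_stableD[OF Int_stable_prod_algebra, of A I' S' B]
      by (auto intro!: exI[of _ "A \<inter> B"])
  qed
  \<comment> \<open>Cylinders form an intersection-stable generator, and each of them restricts only
    finitely many coordinates; on these \<open>fin\<close> gives the product formula.\<close>
  have "indep_set {?X -` A \<inter> space M |A. A \<in> prod_algebra I S}
      {?Y -` A \<inter> space M |A. A \<in> prod_algebra L T}"
  proof (rule indep_setI)
    show "{?X -` A \<inter> space M |A. A \<in> prod_algebra I S} \<subseteq> events"
      using mX by (auto simp: sets_PiM intro!: measurable_sets)
    show "{?Y -` A \<inter> space M |A. A \<in> prod_algebra L T} \<subseteq> events"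
      using mY by (auto simp: sets_PiM intro!: measurable_sets)
    fix a b
    assume "a \<in> {?X -` A \<inter> space M |A. A \<in> prod_algebra I S}"
      and "b \<in> {?Y -` A \<inter> space M |A. A \<in> prod_algebra L T}"
    then obtain A B where a: "a = ?X -` A \<inter> space M" "A \<in> prod_algebra I S"
      and b: "b = ?Y -` B \<inter> space M" "B \<in> prod_algebra L T" by auto
    obtain J E where A: "A = prod_emb I S J (Pi\<^sub>E J E)" "finite J" "J \<subseteq> I"
      "\<And>i. i \<in> J \<Longrightarrow> E i \<in> sets (S i)" using prod_algebraE[OF a(2)] by metis
    obtain K F where B: "B = prod_emb L T K (Pi\<^sub>E K F)" "finite K" "K \<subseteq> L"
      "\<And>i. i \<in> K \<Longrightarrow> F i \<in> sets (T i)" using prod_algebraE[OF b(2)] by metis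
    have a': "a = (\<lambda>\<omega>. \<lambda>t\<in>J. X t \<omega>) -` (Pi\<^sub>E J E) \<inter> space M"
      using measurable_space[OF X] A(3) unfolding a(1) A(1)
      by (auto simp: prod_emb_def PiE_iff Int_absorb2 subset_iff)
    have b': "b = (\<lambda>\<omega>. \<lambda>t\<in>K. Y t \<omega>) -` (Pi\<^sub>E K F) \<inter> space M"
      using measurable_space[OF Y] B(3) unfolding b(1) B(1)
      by (auto simp: prod_emb_def PiE_iff Int_absorb2 subset_iff)
    have "prob ((\<lambda>x. (\<lambda>t\<in>J. X t x, \<lambda>t\<in>K. Y t x)) -` (Pi\<^sub>E J E \<times> Pi\<^sub>E K F) \<inter> space M)
        = prob a * prob b"
      unfolding a' b' using A B by (intro indep_varD[OF fin]) (auto intro!: sets_PiM_I_finite)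
    moreover have "(\<lambda>x. (\<lambda>t\<in>J. X t x, \<lambda>t\<in>K. Y t x)) -` (Pi\<^sub>E J E \<times> Pi\<^sub>E K F) \<inter> space M = a \<inter> b"
      unfolding a' b' by auto
    ultimately show "prob (a \<inter> b) = prob a * prob b" by simp
  qed
  then have "indep_set {?X -` A \<inter> space M |A. A \<in> sets (PiM I S)}
      {?Y -` A \<inter> space M |A. A \<in> sets (PiM L T)}"
    unfolding eqX eqY by (rule indep_set_sigma_sets) (rule stable)+
  moreover have "sigma_sets (space M) {?X -` A \<inter> space M |A. A \<in> sets (PiM I S)}
      = {?X -` A \<inter> space M |A. A \<in> sets (PiM I S)}"
    unfolding eqX by (rule sigma_sets_sigma_sets_eq) auto
  moreover have "sigma_sets (space M) {?Y -` A \<inter> space M |A. A \<in> sets (PiM L T)}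
      = {?Y -` A \<inter> space M |A. A \<in> sets (PiM L T)}"
    unfolding eqY by (rule sigma_sets_sigma_sets_eq) auto
  ultimately show ?thesis
    using mX mY by (simp add: indep_var_eq)
qed

text \<open>Independence is a property of the joint law, which null sets do not affect. It serves to
  replace \<open>W r - W 0\<close> by \<open>W r\<close>, since \<open>W 0\<close> vanishes only
  almost surely.\<close>

lemma (in prob_space) indep_var_cong_AE:
  assumes indep: "indep_var S X T Y" and X': "X' \<in> measurable M S"
    and eq: "AE \<omega> in M. X \<omega> = X' \<omega>"
  shows "indep_var S X' T Y"
proof -
  have m: "X \<in> measurable M S" "Y \<in> measurable M T"
    using indep by (auto dest: indep_var_rv1 indep_var_rv2)
  have "distr M S X' = distr M S X"
    using eq m X' by (intro distr_cong_AE) auto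
  moreover have "distr M (S \<Otimes>\<^sub>M T) (\<lambda>x. (X' x, Y x)) = distr M (S \<Otimes>\<^sub>M T) (\<lambda>x. (X x, Y x))"
    using eq m X' by (intro distr_cong_AE) auto
  ultimately show ?thesis
    using indep X' m by (simp add: indep_var_distribution_eq)
qed

section \<open>Independence of past and future of the noise\<close>

text \<open>All times involved are merged into one increasing sequence passing through
  \<open>s\<close>. Past values are sums of increments before \<open>s\<close>, future differences
  are sums of increments after \<open>s\<close>, and disjoint blocks of independent increments are
  independent.\<close>

lemma (in prob_space) brownian_past_future_indep_finite:
  assumes W: "brownian_motion M W" and s: "0 \<le> s"
    and J: "finite J" "J \<subseteq> {0..s}" and K: "finite K" "K \<subseteq> {0..}"
  shows "indep_var (PiM J (\<lambda>_. borel)) (\<lambda>\<omega>. \<lambda>r\<in>J. W r \<omega>)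
     (PiM K (\<lambda>_. borel)) (\<lambda>\<omega>. \<lambda>r\<in>K. W (s + r) \<omega> - W s \<omega>)"
proof -
  \<comment> \<open>\<open>0\<close> is added so that partial sums telescope down to
    \<open>W 0\<close>, and \<open>s\<close> so that it becomes a point of the sequence at which the
    increments can be split.\<close>
  define P where "P = insert 0 (insert s (J \<union> (+) s ` K))"
  have P: "finite P" "0 \<in> P" "s \<in> P" "\<And>r. r \<in> P \<Longrightarrow> 0 \<le> r"
    using J K s by (auto simp: P_def)
  define n where "n = card P - 1"
  define xs where "xs = sorted_list_of_set P"
  \<comment> \<open>\<open>brownian_motion\<close> quantifies over infinite monotone sequences;
    capping the index at \<open>n\<close> continues the list by its last entry.\<close>
  define t where "t k = xs ! min k n" for k
  have len: "length xs = Suc n"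
    using P card_gt_0_iff[of P] by (auto simp: n_def xs_def)
  have strict: "t k < t j" if "k < j" "j \<le> n" for k j
    using strict_sorted_list_of_set[of P] that len unfolding t_def xs_def
    by (auto simp: sorted_wrt_iff_nth_less min_def)
  have mono: "mono t"
    using sorted_sorted_list_of_set[of P] len unfolding t_def xs_def
    by (intro monoI sorted_nth_mono) auto
  have t_le: "t k \<le> t j \<longleftrightarrow> k \<le> j" if "k \<le> n" "j \<le> n" for k j
    using strict[of j k] that monoD[OF mono, of k j] by (meson leD linorder_not_le)
  have mem: "\<exists>j\<le>n. r = t j" if "r \<in> P" for r
  proof -
    have "r \<in> set xs" using P that by (simp add: xs_def)
    then obtain j where "j < length xs" "r = xs ! j" by (metis in_set_conv_nth)
    then show ?thesis using len by (intro exI[of _ j]) (auto simp: t_def min_def)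
  qed
  have t_in: "t k \<in> P" for k
    using len P(1) nth_mem[of "min k n" xs] by (simp add: t_def xs_def)
  have t0: "t 0 = 0"
  proof -
    obtain j where "0 = t j" using mem[OF P(2)] by auto
    then show ?thesis using monoD[OF mono, of 0 j] P(4)[OF t_in[of 0]] by simp
  qed
  obtain m where m: "m \<le> n" "s = t m" using mem[OF P(3)] by auto
  define D where "D k \<omega> = W (t (Suc k)) \<omega> - W (t k) \<omega>" for k \<omega>
  have ind: "indep_vars (\<lambda>_. borel) D {..<n}"
    using W mono t0 unfolding brownian_motion_def D_def by auto
  have telescope: "(\<Sum>k\<in>{i..<j}. D k \<omega>) = W (t j) \<omega> - W (t i) \<omega>" if "i \<le> j" for i j \<omega>
    unfolding D_def using that by (rule sum_Suc_diff')
  have "indep_var (PiM {..<m} (\<lambda>_. borel)) (\<lambda>\<omega>. \<lambda>k\<in>{..<m}. D k \<omega>)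
     (PiM {m..<n} (\<lambda>_. borel)) (\<lambda>\<omega>. \<lambda>k\<in>{m..<n}. D k \<omega>)"
    using m by (intro indep_var_restrict[OF ind]) auto
  \<comment> \<open>Every \<open>r\<close> in question is some \<open>t j\<close>, so the condition
    \<open>t (Suc k) \<le> r\<close> selects exactly the increments with \<open>k < j\<close>. The
    value at \<open>r\<close> is thereby a function of one block of increments.\<close>
  then have "indep_var (PiM J (\<lambda>_. borel))
       ((\<lambda>f. \<lambda>r\<in>J. \<Sum>k\<in>{k\<in>{..<m}. t (Suc k) \<le> r}. f k) \<circ> (\<lambda>\<omega>. \<lambda>k\<in>{..<m}. D k \<omega>))
     (PiM K (\<lambda>_. borel))
       ((\<lambda>f. \<lambda>r\<in>K. \<Sum>k\<in>{k\<in>{m..<n}. t (Suc k) \<le> s + r}. f k) \<circ> (\<lambda>\<omega>. \<lambda>k\<in>{m..<n}. D k \<omega>))"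
    by (rule indep_var_compose)
      (auto intro!: measurable_restrict borel_measurable_sum measurable_component_singleton)
  also have "((\<lambda>f. \<lambda>r\<in>J. \<Sum>k\<in>{k\<in>{..<m}. t (Suc k) \<le> r}. f k) \<circ> (\<lambda>\<omega>. \<lambda>k\<in>{..<m}. D k \<omega>))
    = (\<lambda>\<omega>. \<lambda>r\<in>J. W r \<omega> - W 0 \<omega>)"
  proof (intro ext)
    fix \<omega> r
    show "((\<lambda>f. \<lambda>r\<in>J. \<Sum>k\<in>{k\<in>{..<m}. t (Suc k) \<le> r}. f k) \<circ> (\<lambda>\<omega>. \<lambda>k\<in>{..<m}. D k \<omega>)) \<omega> r
      = (\<lambda>r\<in>J. W r \<omega> - W 0 \<omega>) r"
    proof (cases "r \<in> J")
      case True
      then obtain j where j: "j \<le> n" "r = t j" using mem[of r] by (auto simp: P_def)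
      have "j \<le> m" using True J(2) t_le[OF j(1) m(1)] j m by auto
      then have "{k\<in>{..<m}. t (Suc k) \<le> r} = {0..<j}"
        using j m t_le by auto
      then have "(\<Sum>k\<in>{k\<in>{..<m}. t (Suc k) \<le> r}. (\<lambda>k\<in>{..<m}. D k \<omega>) k) = (\<Sum>k\<in>{0..<j}. D k \<omega>)"
        by (rule sum.cong) (use \<open>j \<le> m\<close> in auto)
      then show ?thesis using True telescope[of 0 j \<omega>] j t0 by simp
    qed simp
  qed
  also have "((\<lambda>f. \<lambda>r\<in>K. \<Sum>k\<in>{k\<in>{m..<n}. t (Suc k) \<le> s + r}. f k) \<circ> (\<lambda>\<omega>. \<lambda>k\<in>{m..<n}. D k \<omega>))
    = (\<lambda>\<omega>. \<lambda>r\<in>K. W (s + r) \<omega> - W s \<omega>)"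
  proof (intro ext)
    fix \<omega> r
    show "((\<lambda>f. \<lambda>r\<in>K. \<Sum>k\<in>{k\<in>{m..<n}. t (Suc k) \<le> s + r}. f k) \<circ> (\<lambda>\<omega>. \<lambda>k\<in>{m..<n}. D k \<omega>)) \<omega> r
      = (\<lambda>r\<in>K. W (s + r) \<omega> - W s \<omega>) r"
    proof (cases "r \<in> K")
      case True
      then obtain j where j: "j \<le> n" "s + r = t j" using mem[of "s + r"] by (auto simp: P_def)
      have "m \<le> j" using True K(2) t_le[OF m(1) j(1)] j m by force
      have "{k\<in>{m..<n}. t (Suc k) \<le> s + r} = {m..<j}"
        using j t_le by auto
      then have "(\<Sum>k\<in>{k\<in>{m..<n}. t (Suc k) \<le> s + r}. (\<lambda>k\<in>{m..<n}. D k \<omega>) k) = (\<Sum>k\<in>{m..<j}. D k \<omega>)"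
        by (rule sum.cong) (use j in auto)
      then show ?thesis using True telescope[OF \<open>m \<le> j\<close>, of \<omega>] j m by simp
    qed simp
  qed
  finally show ?thesis
  proof (rule indep_var_cong_AE)
    show "(\<lambda>\<omega>. \<lambda>r\<in>J. W r \<omega>) \<in> measurable M (PiM J (\<lambda>_. borel))"
      using W J by (auto simp: brownian_motion_def intro!: measurable_restrict)
    have "AE \<omega> in M. W 0 \<omega> = 0" using W by (simp add: brownian_motion_def)
    then show "AE \<omega> in M. (\<lambda>r\<in>J. W r \<omega> - W 0 \<omega>) = (\<lambda>r\<in>J. W r \<omega>)" by eventually_elim simp
  qed
qed

lemma (in prob_space) brownian_past_future_indep:
  assumes W: "brownian_motion M W" and s: "0 \<le> s"
  shows "indep_var (PiM {0..s} (\<lambda>_. borel)) (\<lambda>\<omega>. \<lambda>r\<in>{0..s}. W r \<omega>)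
     (PiM {0..} (\<lambda>_. borel)) (\<lambda>\<omega>. \<lambda>r\<in>{0..}. W (s + r) \<omega> - W s \<omega>)"
proof (rule indep_var_PiM_finite_subsets)
  have Wm: "W t \<in> borel_measurable M" if "0 \<le> t" for t
    using W that by (simp add: brownian_motion_def)
  show "W t \<in> borel_measurable M" if "t \<in> {0..s}" for t
    using that by (intro Wm) auto
  show "(\<lambda>\<omega>. W (s + t) \<omega> - W s \<omega>) \<in> borel_measurable M" if "t \<in> {0..}" for t
    using that s by (intro borel_measurable_diff Wm) auto
qed (rule brownian_past_future_indep_finite[OF W s])

lemma (in prob_space) brownian_motion_restart:
  assumes W: "brownian_motion M W" and s: "0 \<le> s"
  shows "brownian_motion M (\<lambda>t \<omega>. W (s + t) \<omega> - W s \<omega>)"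
  unfolding brownian_motion_def
proof (intro conjI allI impI)
  from W have indep: "\<forall>(n::nat) (t::nat \<Rightarrow> real). 0 \<le> t 0 \<and> mono t \<longrightarrow>
        indep_vars (\<lambda>_. borel) (\<lambda>k \<omega>. W (t (Suc k)) \<omega> - W (t k) \<omega>) {..<n}"
    unfolding brownian_motion_def by (elim conjE)
  from W have gauss: "\<forall>s t. 0 \<le> s \<and> s < t \<longrightarrow>
        distributed M lborel (\<lambda>\<omega>. W t \<omega> - W s \<omega>) (\<lambda>x. ennreal (normal_density 0 (sqrt (t - s)) x))"
    unfolding brownian_motion_def by (elim conjE)
  show "(\<lambda>\<omega>. W (s + t) \<omega> - W s \<omega>) \<in> borel_measurable M" if "0 \<le> t" for t
    using W s that by (intro borel_measurable_diff) (simp_all add: brownian_motion_def)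
  show "AE \<omega> in M. W (s + 0) \<omega> - W s \<omega> = 0" by simp
  have "AE \<omega> in M. continuous_on {0..} (\<lambda>t. W t \<omega>)" using W by (simp add: brownian_motion_def)
  then show "AE \<omega> in M. continuous_on {0..} (\<lambda>t. W (s + t) \<omega> - W s \<omega>)"
  proof eventually_elim
    case (elim \<omega>)
    show ?case
      using s by (intro continuous_intros continuous_on_compose2[OF elim]) auto
  qed
  show "indep_vars (\<lambda>_. borel)
      (\<lambda>k \<omega>. W (s + t (Suc k)) \<omega> - W s \<omega> - (W (s + t k) \<omega> - W s \<omega>)) {..<n}"
    if "0 \<le> t 0 \<and> mono t" for n and t :: "nat \<Rightarrow> real"
  proof -
    have "mono (\<lambda>k. s + t k)" "0 \<le> s + t 0" using that s by (auto simp: mono_def)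
    then have "indep_vars (\<lambda>_. borel) (\<lambda>k \<omega>. W (s + t (Suc k)) \<omega> - W (s + t k) \<omega>) {..<n}"
      by (intro indep[rule_format] conjI)
    then show ?thesis by simp
  qed
  show "distributed M lborel (\<lambda>\<omega>. W (s + t) \<omega> - W s \<omega> - (W (s + r) \<omega> - W s \<omega>))
      (\<lambda>x. ennreal (normal_density 0 (sqrt (t - r)) x))" if "0 \<le> r \<and> r < t" for r t
  proof -
    have "0 \<le> s + r \<and> s + r < s + t" using that s by auto
    then have "distributed M lborel (\<lambda>\<omega>. W (s + t) \<omega> - W (s + r) \<omega>)
      (\<lambda>x. ennreal (normal_density 0 (sqrt (s + t - (s + r))) x))"
      by (rule gauss[rule_format])
    then show ?thesis by simp
  qed
qed

text \<open>Independence of the pairs over \<open>i\<close> and of the two components within each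
  pair make all the single components jointly independent. These can then be regrouped by component
  instead of by index: all \<open>X i\<close> against all \<open>Y i\<close>.\<close>

lemma (in prob_space) indep_set_sigma_Un_componentwise:
  assumes I: "finite I"
    and indep: "indep_vars (\<lambda>i. S i \<Otimes>\<^sub>M T i) (\<lambda>i \<omega>. (X i \<omega>, Y i \<omega>)) I"
    and XY: "\<And>i. i \<in> I \<Longrightarrow> indep_var (S i) (X i) (T i) (Y i)"
  shows "indep_set (sigma_sets (space M) (\<Union>i\<in>I. {X i -` A \<inter> space M |A. A \<in> sets (S i)}))
    (sigma_sets (space M) (\<Union>i\<in>I. {Y i -` A \<inter> space M |A. A \<in> sets (T i)}))"
proof (cases "I = {}")
  case True
  then show ?thesis
    using prob_space by (auto simp: sigma_sets_empty_eq indep_sets2_eq)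
next
  case False
  define E where "E p = (if snd p then {X (fst p) -` A \<inter> space M |A. A \<in> sets (S (fst p))}
    else {Y (fst p) -` A \<inter> space M |A. A \<in> sets (T (fst p))})" for p
  have XYm: "X i \<in> measurable M (S i)" "Y i \<in> measurable M (T i)" if "i \<in> I" for i
    using XY[OF that] by (auto dest: indep_var_rv1 indep_var_rv2)
  \<comment> \<open>Each family contains the whole space, so the product formula needs checking only
    over the full index set: smaller intersections arise by choosing \<open>space M\<close>.\<close>
  have "indep_sets E (I \<times> UNIV)"
  proof (subst indep_sets_finite)
    show "I \<times> (UNIV :: bool set) \<noteq> {}" "finite (I \<times> (UNIV :: bool set))" using False I by auto
    show "E p \<subseteq> events" if "p \<in> I \<times> UNIV" for p
      using that XYm by (auto simp: E_def)
    show "space M \<in> E p" if "p \<in> I \<times> UNIV" for p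
    proof -
      have "X (fst p) -` space (S (fst p)) \<inter> space M = space M"
        "Y (fst p) -` space (T (fst p)) \<inter> space M = space M"
        using that measurable_space[OF XYm(1)] measurable_space[OF XYm(2)] by auto
      then show ?thesis unfolding E_def
        by (cases "snd p") (simp_all, (metis sets.top)+)
    qed
    show "\<forall>A\<in>Pi (I \<times> UNIV) E. prob (\<Inter>j\<in>I \<times> UNIV. A j) = (\<Prod>j\<in>I \<times> UNIV. prob (A j))"
    proof
      fix A assume A: "A \<in> Pi (I \<times> UNIV) E"
      have "\<forall>i\<in>I. \<exists>C. C \<in> sets (S i) \<and> A (i, True) = X i -` C \<inter> space M"
      proof
        fix i assume "i \<in> I"
        then have "A (i, True) \<in> E (i, True)" using A by auto
        then show "\<exists>C. C \<in> sets (S i) \<and> A (i, True) = X i -` C \<inter> space M" by (auto simp: E_def)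
      qed
      then obtain C where C: "\<And>i. i \<in> I \<Longrightarrow> C i \<in> sets (S i)"
        "\<And>i. i \<in> I \<Longrightarrow> A (i, True) = X i -` C i \<inter> space M" by metis
      have "\<forall>i\<in>I. \<exists>C. C \<in> sets (T i) \<and> A (i, False) = Y i -` C \<inter> space M"
      proof
        fix i assume "i \<in> I"
        then have "A (i, False) \<in> E (i, False)" using A by auto
        then show "\<exists>C. C \<in> sets (T i) \<and> A (i, False) = Y i -` C \<inter> space M" by (auto simp: E_def)
      qed
      then obtain D where D: "\<And>i. i \<in> I \<Longrightarrow> D i \<in> sets (T i)"
        "\<And>i. i \<in> I \<Longrightarrow> A (i, False) = Y i -` D i \<inter> space M" by metis
      have "(\<Inter>j\<in>I \<times> UNIV. A j) = (\<Inter>i\<in>I. A (i, True) \<inter> A (i, False))"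
        by (auto simp: UNIV_bool)
      also have "\<dots> = (\<Inter>i\<in>I. (\<lambda>\<omega>. (X i \<omega>, Y i \<omega>)) -` (C i \<times> D i) \<inter> space M)"
        using C D by (intro INF_cong) auto
      also have "prob \<dots> = (\<Prod>i\<in>I. prob ((\<lambda>\<omega>. (X i \<omega>, Y i \<omega>)) -` (C i \<times> D i) \<inter> space M))"
        using False I C D by (intro indep_varsD_finite[OF indep]) auto
      also have "\<dots> = (\<Prod>i\<in>I. prob (A (i, True)) * prob (A (i, False)))"
        using C D by (intro prod.cong refl) (subst indep_varD[OF XY], auto)
      also have "\<dots> = (\<Prod>i\<in>I. \<Prod>b\<in>UNIV. prob (A (i, b)))"
        by (simp add: UNIV_bool mult.commute)
      also have "\<dots> = (\<Prod>j\<in>I \<times> UNIV. prob (A j))"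
        by (subst prod.Sigma) (auto simp: I)
      finally show "prob (\<Inter>j\<in>I \<times> UNIV. A j) = (\<Prod>j\<in>I \<times> UNIV. prob (A j))" .
    qed
  qed
  \<comment> \<open>The regrouping: \<open>I \<times> {True}\<close> collects all past components,
    \<open>I \<times> {False}\<close> all future ones.\<close>
  then have "indep_sets E (\<Union>b\<in>UNIV. I \<times> {b})" by (rule indep_sets_mono_index[rotated]) auto
  then have "indep_sets (\<lambda>b. sigma_sets (space M) (\<Union>p\<in>I \<times> {b}. E p)) UNIV"
  proof (rule indep_sets_collect_sigma)
    show "Int_stable (E p)" for p
    proof (rule Int_stableI)
      fix a b assume ab: "a \<in> E p" "b \<in> E p"
      have "\<exists>C. (f -` A \<inter> space M) \<inter> (f -` B \<inter> space M) = f -` C \<inter> space M \<and> C \<in> sets N"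
        if "A \<in> sets N" "B \<in> sets N" for f :: "'a \<Rightarrow> 'z" and N A B
        using that by (intro exI[of _ "A \<inter> B"]) auto
      note * = this
      show "a \<inter> b \<in> E p"
      proof (cases "snd p")
        case True
        then show ?thesis using ab unfolding E_def
          by (auto simp del: vimage_Int) (rule *)
      next
        case False
        then show ?thesis using ab unfolding E_def
          by (auto simp del: vimage_Int) (rule *)
      qed
    qed
    show "disjoint_family_on (\<lambda>b. I \<times> {b}) UNIV" by (auto simp: disjoint_family_on_def)
  qed
  moreover have "(\<Union>p\<in>I \<times> {b}. E p) = (\<Union>i\<in>I. E (i, b))" for b by auto
  ultimately have "indep_sets (\<lambda>b. sigma_sets (space M) (\<Union>i\<in>I. E (i, b))) UNIV" by simp
  moreover have "(\<lambda>b. sigma_sets (space M) (\<Union>i\<in>I. E (i, b))) =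
    case_bool (sigma_sets (space M) (\<Union>i\<in>I. {X i -` A \<inter> space M |A. A \<in> sets (S i)}))
      (sigma_sets (space M) (\<Union>i\<in>I. {Y i -` A \<inter> space M |A. A \<in> sets (T i)}))"
    by (simp add: fun_eq_iff E_def split: bool.split)
  ultimately show ?thesis
    unfolding indep_set_def by simp
qed

section \<open>Sigma-algebras generated by the noise\<close>

lemma space_history [simp]: "space (history M N B T) = space M"
  by (simp add: history_def)

lemma measurable_history:
  assumes "i < N" "r \<in> T"
  shows "B i r \<in> borel_measurable (history M N B T)"
proof -
  let ?f = "\<lambda>\<omega>. \<lambda>(i, s)\<in>{..<N} \<times> T. B i s \<omega>"
  have "?f \<in> measurable (history M N B T) (PiM ({..<N} \<times> T) (\<lambda>_. borel))"
    unfolding history_def by (rule measurable_vimage_algebra1) (auto simp: space_PiM)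
  then have "(\<lambda>\<omega>. ?f \<omega> (i, r)) \<in> borel_measurable (history M N B T)"
    by (rule measurable_compose) (use assms in \<open>auto intro!: measurable_component_singleton\<close>)
  then show ?thesis using assms by simp
qed

lemma sets_history_subset:
  assumes Q: "space Q = space M"
    and B: "\<And>i r. i < N \<Longrightarrow> r \<in> T \<Longrightarrow> B i r \<in> borel_measurable Q"
  shows "sets (history M N B T) \<subseteq> sets Q"
proof -
  let ?f = "\<lambda>\<omega>. \<lambda>(i, s)\<in>{..<N} \<times> T. B i s \<omega>"
  have "?f \<in> measurable Q (PiM ({..<N} \<times> T) (\<lambda>_. borel))"
    using B by (auto intro!: measurable_restrict)
  then have "{?f -` A \<inter> space M |A. A \<in> sets (PiM ({..<N} \<times> T) (\<lambda>_. borel))} \<subseteq> sets Q"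
    using measurable_sets[of ?f Q] Q by auto
  then show ?thesis
    unfolding history_def sets_vimage_algebra using Q sets.sigma_sets_subset[of _ Q] by simp
qed

lemma space_noise_filtration [simp]: "space (noise_filtration M F0 N B t) = space M"
  by (simp add: noise_filtration_def space_measure_of_conv)

lemma sets_noise_filtration:
  assumes "subalgebra M F0"
  shows "sets (noise_filtration M F0 N B t)
    = sigma_sets (space M) (sets F0 \<union> sets (history M N B {0..t}) \<union> null_sets M)"
  unfolding noise_filtration_def
proof (rule sets_measure_of)
  show "sets F0 \<union> sets (history M N B {0..t}) \<union> null_sets M \<subseteq> Pow (space M)"
    using assms sets.space_closed[of F0] sets.space_closed[of "history M N B {0..t}"]
      sets.sets_into_space[of _ M] by (auto simp: subalgebra_def)
qed

lemma sets_noise_filtration_subset: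
  assumes F0: "subalgebra M F0" and Q: "space Q = space M" "sets F0 \<subseteq> sets Q" "null_sets M \<subseteq> sets Q"
    and B: "\<And>i r. i < N \<Longrightarrow> 0 \<le> r \<Longrightarrow> r \<le> t \<Longrightarrow> B i r \<in> borel_measurable Q"
  shows "sets (noise_filtration M F0 N B t) \<subseteq> sets Q"
proof -
  have "sets (history M N B {0..t}) \<subseteq> sets Q"
    using Q B by (intro sets_history_subset) auto
  then show ?thesis
    unfolding sets_noise_filtration[OF F0] using Q sets.sigma_sets_subset[of _ Q] by simp
qed

lemma noise_filtration_supersets:
  assumes "subalgebra M F0"
  shows "sets F0 \<subseteq> sets (noise_filtration M F0 N B t)"
    and "sets (history M N B {0..t}) \<subseteq> sets (noise_filtration M F0 N B t)"
    and "null_sets M \<subseteq> sets (noise_filtration M F0 N B t)"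
  unfolding sets_noise_filtration[OF assms] by auto

lemma measurable_from_sets_subset:
  assumes "f \<in> measurable P R" "space P = space Q" "sets P \<subseteq> sets Q"
  shows "f \<in> measurable Q R"
  using measurable_mono[of R R P Q] assms by auto

text \<open>For \<open>a\<close> in \<open>F0\<close>, \<open>b\<close> in the noise up to
  \<open>s\<close> and \<open>c\<close> in the later increments, the independence of
  \<open>F0\<close> from the whole noise splits off \<open>a\<close> from
  \<open>b \<inter> c\<close>, and the independence of past and future of the noise splits
  \<open>b\<close> from \<open>c\<close>. The sets \<open>a \<inter> b\<close> together with the
  null sets generate the filtration at time \<open>s\<close>.\<close>

lemma driving_noise_restart:
  assumes M: "prob_space M" and F0: "subalgebra M F0" and B: "driving_noise M F0 N B" and s: "0 \<le> s"
  shows "driving_noise M (noise_filtration M F0 N B s) N (\<lambda>i t \<omega>. B i (s + t) \<omega> - B i s \<omega>)"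
proof -
  interpret prob_space M by (rule M)
  let ?B = "\<lambda>i t \<omega>. B i (s + t) \<omega> - B i s \<omega>"
  let ?P = "\<lambda>T. PiM T (\<lambda>_. borel :: real measure)"
  have brown: "brownian_motion M (B i)" if "i < N" for i
    using B that by (simp add: driving_noise_def)
  have paths: "indep_vars (\<lambda>_. ?P {0..}) (\<lambda>i \<omega>. \<lambda>s\<in>{0..}. B i s \<omega>) {..<N}"
    using B by (simp add: driving_noise_def)
  have indep0: "indep_set (sets F0) (sets (history M N B {0..}))"
    using B by (simp add: driving_noise_def)
  have coord: "(\<lambda>f. f r) \<in> borel_measurable (?P {0..})" if "0 \<le> r" for r
    using that by (intro measurable_component_singleton) auto
  have past_m: "(\<lambda>f. \<lambda>r\<in>{0..s}. f r) \<in> measurable (?P {0..}) (?P {0..s})"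
    by (intro measurable_restrict coord) auto
  have future_m: "(\<lambda>f. \<lambda>r\<in>{0..}. f (s + r) - f s) \<in> measurable (?P {0..}) (?P {0..})"
    using s by (intro measurable_restrict borel_measurable_diff coord) auto
  have "indep_vars (\<lambda>_. ?P {0..}) (\<lambda>i \<omega>. \<lambda>r\<in>{0..}. ?B i r \<omega>) {..<N}"
  proof -
    have "indep_vars (\<lambda>_. ?P {0..})
      (\<lambda>i \<omega>. (\<lambda>f. \<lambda>r\<in>{0..}. f (s + r) - f s) (\<lambda>s\<in>{0..}. B i s \<omega>)) {..<N}"
      by (rule indep_vars_compose2[OF paths]) (rule future_m)
    moreover have "(\<lambda>f. \<lambda>r\<in>{0..}. f (s + r) - f s) (\<lambda>s\<in>{0..}. B i s \<omega>)
      = (\<lambda>r\<in>{0..}. ?B i r \<omega>)" for i \<omega>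
      using s by (auto simp: fun_eq_iff)
    ultimately show ?thesis by simp
  qed
  moreover have "brownian_motion M (?B i)" if "i < N" for i
    using brownian_motion_restart[OF brown[OF that] s] .
  moreover have "indep_set (sets (noise_filtration M F0 N B s)) (sets (history M N ?B {0..}))"
  proof -
    let ?past = "history M N B {0..s}" and ?future = "history M N ?B {0..}"
    let ?X = "\<lambda>i \<omega>. \<lambda>r\<in>{0..s}. B i r \<omega>" and ?Y = "\<lambda>i \<omega>. \<lambda>r\<in>{0..}. ?B i r \<omega>"
    let ?EX = "\<Union>i\<in>{..<N}. {?X i -` A \<inter> space M |A. A \<in> sets (?P {0..s})}"
    let ?EY = "\<Union>i\<in>{..<N}. {?Y i -` A \<inter> space M |A. A \<in> sets (?P {0..})}"
    \<comment> \<open>Past and future of particle \<open>i\<close> are both functions of its whole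
      noise path, so independence between particles carries over to these pairs.\<close>
    have "indep_vars (\<lambda>_. ?P {0..s} \<Otimes>\<^sub>M ?P {0..})
      (\<lambda>i \<omega>. (\<lambda>f. (\<lambda>r\<in>{0..s}. f r, \<lambda>r\<in>{0..}. f (s + r) - f s)) (\<lambda>s\<in>{0..}. B i s \<omega>)) {..<N}"
      by (rule indep_vars_compose2[OF paths]) (rule measurable_Pair[OF past_m future_m])
    moreover have "(\<lambda>f. (\<lambda>r\<in>{0..s}. f r, \<lambda>r\<in>{0..}. f (s + r) - f s)) (\<lambda>s\<in>{0..}. B i s \<omega>)
      = (?X i \<omega>, ?Y i \<omega>)" for i \<omega>
      using s by (auto simp: fun_eq_iff)
    ultimately have "indep_vars (\<lambda>_. ?P {0..s} \<Otimes>\<^sub>M ?P {0..}) (\<lambda>i \<omega>. (?X i \<omega>, ?Y i \<omega>)) {..<N}"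
      by simp
    then have indep: "indep_set (sigma_sets (space M) ?EX) (sigma_sets (space M) ?EY)"
      using brown s by (intro indep_set_sigma_Un_componentwise brownian_past_future_indep) auto
    \<comment> \<open>Translates between the joint history, indexed by pairs of particle and time,
      and the path of each particle separately.\<close>
    have generated: "sets (history M N C T) \<subseteq> sigma_sets (space M)
        (\<Union>i\<in>{..<N}. {(\<lambda>\<omega>. \<lambda>r\<in>T. C i r \<omega>) -` A \<inter> space M |A. A \<in> sets (?P T)})" (is "_ \<subseteq> sigma_sets _ ?E")
      for C T
    proof -
      have E: "?E \<subseteq> Pow (space M)" by auto
      have "C i r \<in> borel_measurable (sigma (space M) ?E)" if "i < N" "r \<in> T" for i r
      proof (rule measurableI)
        fix A :: "real set" assume "A \<in> sets borel"
        then have "(\<lambda>f. f r) -` A \<inter> space (?P T) \<in> sets (?P T)"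
          using that by (intro measurable_sets[OF measurable_component_singleton]) auto
        moreover have "C i r -` A \<inter> space M
            = (\<lambda>\<omega>. \<lambda>r\<in>T. C i r \<omega>) -` ((\<lambda>f. f r) -` A \<inter> space (?P T)) \<inter> space M"
          using that by (auto simp: space_PiM)
        ultimately have "C i r -` A \<inter> space M \<in> ?E" using that by blast
        then show "C i r -` A \<inter> space (sigma (space M) ?E) \<in> sets (sigma (space M) ?E)"
          using E by (simp add: sets_measure_of)
      qed auto
      then have "sets (history M N C T) \<subseteq> sets (sigma (space M) ?E)"
        by (intro sets_history_subset) (simp_all add: space_measure_of_conv)
      then show ?thesis using E by (simp add: sets_measure_of)
    qed
    have past_future: "prob (a \<inter> b) = prob a * prob b"
      if "a \<in> sets ?past" "b \<in> sets ?future" for a b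
      using that generated[of B "{0..s}"] generated[of ?B "{0..}"] by (intro indep_setD[OF indep]) auto
    have past_sub: "sets ?past \<subseteq> sets (history M N B {0..})"
      by (intro sets_history_subset measurable_history) auto
    have future_sub: "sets ?future \<subseteq> sets (history M N B {0..})"
      using s by (intro sets_history_subset borel_measurable_diff measurable_history) auto
    have hist_events: "sets (history M N B {0..}) \<subseteq> events" and F0_events: "sets F0 \<subseteq> events"
      using indep0 by (auto dest: indep_setD_ev1 indep_setD_ev2)
    \<comment> \<open>An intersection-stable generator of the filtration. Null sets are adjoined as
      whole alternatives: intersecting one with an event gives a null set again, and both sides of
      the product formula vanish on it.\<close>
    let ?G = "{a \<inter> b |a b. a \<in> sets F0 \<and> b \<in> sets ?past} \<union> null_sets M"
    have "indep_set ?G (sets ?future)"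
    proof (rule indep_setI)
      show "?G \<subseteq> events" using F0_events hist_events past_sub by auto
      show "sets ?future \<subseteq> events" using hist_events future_sub by auto
      fix g c assume g: "g \<in> ?G" and c: "c \<in> sets ?future"
      from g consider a b where "g = a \<inter> b" "a \<in> sets F0" "b \<in> sets ?past" | "g \<in> null_sets M" by auto
      then show "prob (g \<inter> c) = prob g * prob c"
      proof cases
        case 1
        have "prob (a \<inter> (b \<inter> c)) = prob a * prob (b \<inter> c)"
          using 1 c past_sub future_sub by (intro indep_setD[OF indep0]) auto
        moreover have "prob (a \<inter> b) = prob a * prob b"
          using 1 past_sub by (intro indep_setD[OF indep0]) auto
        ultimately show ?thesis using past_future[OF 1(3) c] 1(1) by (simp add: Int_assoc)
      next
        case 2
        then have "g \<inter> c \<in> null_sets M"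
          using c hist_events future_sub by (intro null_set_Int2) auto
        then show ?thesis using 2 by (simp add: measure_eq_0_null_sets)
      qed
    qed
    moreover have "Int_stable ?G"
    proof (rule Int_stableI)
      fix g h assume gh: "g \<in> ?G" "h \<in> ?G"
      have ev: "g \<in> events" "h \<in> events" using gh F0_events hist_events past_sub by auto
      show "g \<inter> h \<in> ?G"
      proof (cases "g \<in> null_sets M \<or> h \<in> null_sets M")
        case True
        then have "g \<inter> h \<in> null_sets M" using ev by (auto intro: null_set_Int1 null_set_Int2)
        then show ?thesis by simp
      next
        case False
        then obtain a b a' b' where "g = a \<inter> b" "h = a' \<inter> b'" "a \<in> sets F0" "a' \<in> sets F0"
          "b \<in> sets ?past" "b' \<in> sets ?past" using gh by auto
        then have "g \<inter> h = (a \<inter> a') \<inter> (b \<inter> b')" "a \<inter> a' \<in> sets F0" "b \<inter> b' \<in> sets ?past" by auto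
        then show ?thesis by blast
      qed
    qed
    ultimately have "indep_set (sigma_sets (space M) ?G) (sigma_sets (space M) (sets ?future))"
      by (intro indep_set_sigma_sets) (auto intro: sets.Int_stable)
    moreover have "sets (noise_filtration M F0 N B s) \<subseteq> sigma_sets (space M) ?G"
      unfolding sets_noise_filtration[OF F0]
    proof (rule sigma_sets_mono)
      have top: "space M \<in> sets F0" "space M \<in> sets ?past"
        using F0 sets.top[of F0] sets.top[of ?past] by (auto simp: subalgebra_def)
      have "a \<in> ?G" if "a \<in> sets F0" for a
      proof -
        have "a = a \<inter> space M" using sets.sets_into_space[OF that] F0 by (auto simp: subalgebra_def)
        then show ?thesis using that top by blast
      qed
      moreover have "b \<in> ?G" if "b \<in> sets ?past" for b
      proof -
        have "b = space M \<inter> b" using sets.sets_into_space[OF that] by auto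
        then show ?thesis using that top by blast
      qed
      ultimately show "sets F0 \<union> sets ?past \<union> null_sets M \<subseteq> sigma_sets (space M) ?G"
        by (auto intro: sigma_sets.Basic)
    qed
    moreover have "sigma_sets (space M) (sets ?future) = sets ?future"
      using sets.sigma_sets_eq[of ?future] by simp
    ultimately show ?thesis by (auto simp: indep_sets2_eq)
  qed
  ultimately show ?thesis by (simp add: driving_noise_def)
qed

section \<open>The shifted equation\<close>

lemma AE_lborel_translate:
  fixes s :: real
  assumes "AE x in lborel. P x"
  shows "AE x in lborel. P (s + x)"
proof -
  have "AE x in distr lborel borel ((+) s). P x" using assms by (simp only: lborel_distr_plus)
  then show ?thesis by (rule AE_distrD[rotated]) simp
qed

text \<open>The drift depends on time only through the configuration, so subtracting the equation at
  time \<open>s\<close> from the one at \<open>s + t\<close> leaves the same equation with shifted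
  noise. The delicate part is adaptedness: the filtration of the shifted system at \<open>t\<close>
  has to contain the original one at \<open>s + t\<close>.\<close>

lemma strong_solution_restart:
  assumes X: "strong_solution M F0 N \<sigma> U V B X" and s: "0 \<le> s"
  shows "strong_solution M (noise_filtration M F0 N B s) N \<sigma> U V
    (\<lambda>i t \<omega>. B i (s + t) \<omega> - B i s \<omega>) (\<lambda>i t. X i (s + t))"
proof -
  let ?F = "noise_filtration M F0 N B s" and ?B = "\<lambda>i t \<omega>. B i (s + t) \<omega> - B i s \<omega>"
  from X have M: "prob_space M" and F0: "subalgebra M F0" and B: "driving_noise M F0 N B"
    and X_m: "\<And>i t. i < N \<Longrightarrow> 0 \<le> t \<Longrightarrow> X i t \<in> borel_measurable (noise_filtration M F0 N B t)"
    and AE_X: "AE \<omega> in M.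
        (\<forall>i<N. continuous_on {0..} (\<lambda>t. X i t \<omega>)) \<and>
        (\<forall>t\<ge>0. mono_on {..<N} (\<lambda>i. X i t \<omega>)) \<and>
        (\<forall>i<N. \<forall>j<N. i \<noteq> j \<longrightarrow>
           (AE s in lborel. 0 \<le> s \<longrightarrow> V differentiable (at (X i s \<omega> - X j s \<omega>)))) \<and>
        (\<forall>i<N. \<forall>t\<ge>0.
           (\<lambda>s. drift U V N (\<lambda>j. X j s \<omega>) i) absolutely_integrable_on {0..t} \<and>
           X i t \<omega> = X i 0 \<omega> + sqrt (2 * \<sigma>) * B i t \<omega>
                      + integral {0..t} (\<lambda>s. drift U V N (\<lambda>j. X j s \<omega>) i))"
    by (auto simp: strong_solution_def)
  have B_m: "B i r \<in> borel_measurable M" if "i < N" "0 \<le> r" for i r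
    using B that by (auto simp: driving_noise_def brownian_motion_def)
  have F: "subalgebra M ?F"
    using F0 B_m unfolding subalgebra_def[of M ?F]
    by (intro conjI sets_noise_filtration_subset) (simp_all add: subalgebra_def null_sets_def subset_eq)
  have F_in: "sets ?F \<subseteq> sets (noise_filtration M ?F N ?B t)" for t
    by (rule noise_filtration_supersets[OF F])
  have B_F: "B i r \<in> borel_measurable ?F" if "i < N" "0 \<le> r" "r \<le> s" for i r
    using that by (intro measurable_from_sets_subset[OF measurable_history[of i N r "{0..s}" B M]]
      noise_filtration_supersets[OF F0]) auto
  \<comment> \<open>Beyond \<open>s\<close> the old noise is recovered as the restarted noise at
    \<open>r - s\<close> plus \<open>B i s\<close>, which belongs to the new initial
    sigma-algebra.\<close>
  have B_m': "B i r \<in> borel_measurable (noise_filtration M ?F N ?B t)"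
    if "i < N" "0 \<le> r" "r \<le> s + t" for i r t
  proof (cases "r \<le> s")
    case True
    then show ?thesis using that F_in
      by (intro measurable_from_sets_subset[OF B_F]) auto
  next
    case False
    then have "?B i (r - s) \<in> borel_measurable (noise_filtration M ?F N ?B t)"
      using that by (intro measurable_from_sets_subset[OF measurable_history[of i N "r - s" "{0..t}" ?B M]]
        noise_filtration_supersets[OF F]) auto
    moreover have "B i s \<in> borel_measurable (noise_filtration M ?F N ?B t)"
      using that s F_in by (intro measurable_from_sets_subset[OF B_F]) auto
    ultimately have "(\<lambda>\<omega>. ?B i (r - s) \<omega> + B i s \<omega>) \<in> borel_measurable (noise_filtration M ?F N ?B t)"
      by (rule borel_measurable_add)
    then show ?thesis by simp
  qed
  have nested: "sets (noise_filtration M F0 N B (s + t)) \<subseteq> sets (noise_filtration M ?F N ?B t)" for t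
  proof (rule sets_noise_filtration_subset[OF F0])
    show "sets F0 \<subseteq> sets (noise_filtration M ?F N ?B t)"
      using noise_filtration_supersets(1)[OF F0] F_in by blast
    show "null_sets M \<subseteq> sets (noise_filtration M ?F N ?B t)"
      by (rule noise_filtration_supersets[OF F])
  qed (auto intro: B_m')
  show ?thesis
    unfolding strong_solution_def
  proof (intro conjI allI impI M F)
    show "driving_noise M ?F N ?B"
      by (rule driving_noise_restart[OF M F0 B s])
    show "X i (s + 0) \<in> borel_measurable ?F" if "i < N" for i
      using X_m[OF that s] by simp
    show "X i (s + t) \<in> borel_measurable (noise_filtration M ?F N ?B t)" if "i < N" "0 \<le> t" for i t
      using that s by (intro measurable_from_sets_subset[OF X_m _ nested]) auto
    from AE_X show "AE \<omega> in M.
        (\<forall>i<N. continuous_on {0..} (\<lambda>t. X i (s + t) \<omega>)) \<and>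
        (\<forall>t\<ge>0. mono_on {..<N} (\<lambda>i. X i (s + t) \<omega>)) \<and>
        (\<forall>i<N. \<forall>j<N. i \<noteq> j \<longrightarrow>
           (AE r in lborel. 0 \<le> r \<longrightarrow> V differentiable (at (X i (s + r) \<omega> - X j (s + r) \<omega>)))) \<and>
        (\<forall>i<N. \<forall>t\<ge>0.
           (\<lambda>r. drift U V N (\<lambda>j. X j (s + r) \<omega>) i) absolutely_integrable_on {0..t} \<and>
           X i (s + t) \<omega> = X i (s + 0) \<omega> + sqrt (2 * \<sigma>) * (B i (s + t) \<omega> - B i s \<omega>)
                      + integral {0..t} (\<lambda>r. drift U V N (\<lambda>j. X j (s + r) \<omega>) i))"
    proof eventually_elim
      case (elim \<omega>)
      note cont = elim[THEN conjunct1, rule_format]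
        and ordered = elim[THEN conjunct2, THEN conjunct1, rule_format]
        and diff = elim[THEN conjunct2, THEN conjunct2, THEN conjunct1, rule_format]
        and eqn = elim[THEN conjunct2, THEN conjunct2, THEN conjunct2, rule_format]
      show ?case
      proof (intro conjI allI impI)
        show "continuous_on {0..} (\<lambda>t. X i (s + t) \<omega>)" if "i < N" for i
          using s by (intro continuous_on_compose2[OF cont[OF that]] continuous_intros) auto
        show "mono_on {..<N} (\<lambda>i. X i (s + t) \<omega>)" if "0 \<le> t" for t
          using ordered[of "s + t"] s that by simp
        show "AE r in lborel. 0 \<le> r \<longrightarrow> V differentiable (at (X i (s + r) \<omega> - X j (s + r) \<omega>))"
          if "i < N" "j < N" "i \<noteq> j" for i j
          using AE_lborel_translate[OF diff[OF that], of s] by eventually_elim (use s in auto)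
        fix i and t :: real assume i: "i < N" and t: "0 \<le> t"
        let ?d = "\<lambda>r. drift U V N (\<lambda>j. X j r \<omega>) i"
        have int: "?d absolutely_integrable_on {0..s + t}"
          and eqt: "X i (s + t) \<omega> = X i 0 \<omega> + sqrt (2 * \<sigma>) * B i (s + t) \<omega> + integral {0..s + t} ?d"
          and eqs: "X i s \<omega> = X i 0 \<omega> + sqrt (2 * \<sigma>) * B i s \<omega> + integral {0..s} ?d"
          using eqn[OF i, of "s + t"] eqn[OF i, of s] s t by simp_all
        have int_st: "?d absolutely_integrable_on {s..s + t}"
          using s by (intro absolutely_integrable_on_subinterval[OF int]) auto
        then show "(\<lambda>r. ?d (s + r)) absolutely_integrable_on {0..t}"
          using integrable_on_shift_Icc_real[of ?d s 0 t]
            integrable_on_shift_Icc_real[of "\<lambda>r. norm (?d r)" s 0 t]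
          by (simp add: absolutely_integrable_on_def o_def add.commute)
        have "integral {0..s} ?d + integral {s..s + t} ?d = integral {0..s + t} ?d"
          using s t int by (intro Henstock_Kurzweil_Integration.integral_combine) (auto simp: absolutely_integrable_on_def)
        moreover have "integral {0..t} (\<lambda>r. ?d (s + r)) = integral {s..s + t} ?d"
          using integral_shift_Icc_real[of 0 t ?d s] by (simp add: o_def add.commute)
        ultimately show "X i (s + t) \<omega> = X i (s + 0) \<omega> + sqrt (2 * \<sigma>) * (B i (s + t) \<omega> - B i s \<omega>)
                      + integral {0..t} (\<lambda>r. ?d (s + r))"
          using eqt eqs by (simp add: algebra_simps)
      qed
    qed
  qed
qed

section \<open>Quantile functions on the unit interval\<close>

text \<open>The interval is open because a generalised inverse of a distribution function need not
  be finite at 0 or 1, and because \<open>u = 1\<close> would make \<open>step_quantile\<close> read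
  the index \<open>n\<close>.\<close>

abbreviation unit_uniform :: "real measure" where
  "unit_uniform \<equiv> restrict_space lborel {0<..<1}"

lemma space_unit_uniform [simp]: "space unit_uniform = {0<..<1}"
  by (simp add: space_restrict_space)

interpretation unit_uniform: prob_space unit_uniform
  by (rule prob_spaceI) (simp add: emeasure_restrict_space)

lemma emeasure_unit_uniform:
  "A \<in> sets borel \<Longrightarrow> A \<subseteq> {0<..<1} \<Longrightarrow> emeasure unit_uniform A = emeasure lborel A"
  by (simp add: emeasure_restrict_space)

lemma AE_unit_uniform_notin_countable:
  assumes "countable C"
  shows "AE u in unit_uniform. u \<notin> C"
proof (rule AE_I)
  show "{u \<in> space unit_uniform. \<not> u \<notin> C} \<subseteq> C \<inter> {0<..<1}" by auto
  have "countable (C \<inter> {0<..<1})" using assms by auto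
  then show "emeasure unit_uniform (C \<inter> {0<..<1}) = 0"
    using sets.countable[of "C \<inter> {0<..<1}" borel]
    by (subst emeasure_unit_uniform) (simp_all add: emeasure_lborel_countable)
  show "C \<inter> {0<..<1} \<in> sets unit_uniform"
    using sets.countable[OF _ \<open>countable (C \<inter> {0<..<1})\<close>, of borel]
    by (simp add: sets_restrict_space_iff)
qed

text \<open>For every \<open>x\<close> this map carries the uniform law to the empirical measure;
  increasing \<open>x\<close> makes it the right-continuous quantile function.\<close>

definition step_quantile :: "nat \<Rightarrow> (nat \<Rightarrow> real) \<Rightarrow> real \<Rightarrow> real" where
  "step_quantile n x u = x (nat \<lfloor>real n * u\<rfloor>)"

text \<open>The left-continuous generalised inverse of the distribution function, meant for
  \<open>u\<close> in the open unit interval.\<close>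

definition quantile :: "real measure \<Rightarrow> real \<Rightarrow> real" where
  "quantile \<rho> u = Inf {x. u \<le> cdf \<rho> x}"

lemma nat_floor_less:
  assumes "0 < u" "u < 1" "n \<ge> 1"
  shows "nat \<lfloor>real n * u\<rfloor> < n"
proof -
  have "real n * u < real n" using assms by simp
  then have "\<lfloor>real n * u\<rfloor> < int n" by linarith
  then show ?thesis using assms by linarith
qed

lemma measurable_nat_floor:
  assumes "n \<ge> 1"
  shows "(\<lambda>u. nat \<lfloor>real n * u\<rfloor>) \<in> measurable unit_uniform (count_space {..<n})"
proof -
  have "(\<lambda>u::real. nat \<lfloor>real n * u\<rfloor>) \<in> measurable borel (count_space UNIV)" by measurable
  then have "(\<lambda>u::real. nat \<lfloor>real n * u\<rfloor>) \<in> measurable unit_uniform (count_space UNIV)"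
    by (intro measurable_restrict_space1) simp
  then show ?thesis
    using nat_floor_less[OF _ _ assms] by (auto simp: measurable_count_space_eq2_countable)
qed

lemma distr_nat_floor:
  assumes n: "n \<ge> 1"
  shows "distr unit_uniform (count_space {..<n}) (\<lambda>u. nat \<lfloor>real n * u\<rfloor>) = uniform_count_measure {..<n}"
proof (rule measure_eqI_finite[where A="{..<n}"])
  fix i assume i: "i \<in> {..<n}"
  let ?S = "{u\<in>{0<..<1}. nat \<lfloor>real n * u\<rfloor> = i}"
  have mS: "?S \<in> sets borel" by measurable
  have "emeasure (distr unit_uniform (count_space {..<n}) (\<lambda>u. nat \<lfloor>real n * u\<rfloor>)) {i}
    = emeasure unit_uniform ?S"
    using i by (subst emeasure_distr[OF measurable_nat_floor[OF n]]) (auto intro!: arg_cong[where f="emeasure _"])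
  also have "\<dots> = emeasure lborel ?S" using mS by (intro emeasure_unit_uniform) auto
  \<comment> \<open>Passing to the open cell drops at most the left end point
    \<open>real i / n\<close>, which is a null set.\<close>
  also have "\<dots> = emeasure lborel {real i / n<..<(real i + 1) / n}"
  proof (rule emeasure_eq_AE)
    show "AE u in lborel. (u \<in> ?S) = (u \<in> {real i / n<..<(real i + 1) / n})"
      using AE_lborel_singleton[of "real i / n"]
    proof eventually_elim
      case (elim u)
      have "u \<in> ?S \<longleftrightarrow> u \<in> {0<..<1} \<and> real i \<le> real n * u \<and> real n * u < real i + 1"
      proof (cases "u \<in> {0<..<1}")
        case True
        then have "0 \<le> real n * u" by simp
        moreover have "nat \<lfloor>real n * u\<rfloor> = i \<longleftrightarrow> \<lfloor>real n * u\<rfloor> = int i" using calculation by linarith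
        ultimately show ?thesis using True by (simp add: floor_eq_iff)
      qed auto
      also have "\<dots> \<longleftrightarrow> u \<in> {real i / n<..<(real i + 1) / n}"
      proof -
        have "real i \<le> real n * u \<longleftrightarrow> real i / n < u"
          using elim n by (auto simp: field_simps)
        moreover have "real n * u < real i + 1 \<longleftrightarrow> u < (real i + 1) / n"
          using n by (simp add: field_simps)
        moreover have "0 \<le> real i / n" by simp
        moreover have "(real i + 1) / n \<le> 1" using i n by (simp add: field_simps)
        ultimately show ?thesis by (auto intro: le_less_trans[of 0 "real i / n"])
      qed
      finally show ?case .
    qed
  qed (use mS in auto)
  also have "\<dots> = ennreal (1 / n)" using n by (simp add: divide_simps flip: diff_divide_distrib)
  also have "\<dots> = emeasure (uniform_count_measure {..<n}) {i}"
    using i by (simp add: emeasure_uniform_count_measure)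
  finally show "emeasure (distr unit_uniform (count_space {..<n}) (\<lambda>u. nat \<lfloor>real n * u\<rfloor>)) {i}
    = emeasure (uniform_count_measure {..<n}) {i}" .
qed (auto simp: sets_uniform_count_measure)

lemma measurable_step_quantile_fixed:
  assumes "n \<ge> 1"
  shows "step_quantile n x \<in> borel_measurable unit_uniform"
  unfolding step_quantile_def[abs_def]
  by (rule measurable_compose[OF measurable_nat_floor[OF assms]]) simp

lemma distr_step_quantile:
  assumes "n \<ge> 1"
  shows "distr unit_uniform borel (step_quantile n x) = empirical_measure n x"
  unfolding empirical_measure_def distr_nat_floor[OF assms, symmetric]
  by (subst distr_distr[OF _ measurable_nat_floor[OF assms]]) (auto simp: step_quantile_def[abs_def] o_def)

lemma nn_integral_step:
  assumes n: "n \<ge> 1"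
  shows "(\<integral>\<^sup>+u. f (nat \<lfloor>real n * u\<rfloor>) \<partial>unit_uniform) = (\<Sum>i<n. ennreal (1 / n) * f i)"
proof -
  have "(\<integral>\<^sup>+u. f (nat \<lfloor>real n * u\<rfloor>) \<partial>unit_uniform) = (\<integral>\<^sup>+i. f i \<partial>uniform_count_measure {..<n})"
    unfolding distr_nat_floor[OF n, symmetric]
    by (subst nn_integral_distr[OF measurable_nat_floor[OF n]]) auto
  also have "\<dots> = (\<Sum>i<n. ennreal (1 / n) * f i)"
    unfolding uniform_count_measure_def by (simp add: nn_integral_point_measure_finite)
  finally show ?thesis .
qed

lemma nn_integral_step_real:
  assumes n: "n \<ge> 1" and f: "\<And>i. i < n \<Longrightarrow> 0 \<le> f i"
  shows "(\<integral>\<^sup>+u. ennreal (f (nat \<lfloor>real n * u\<rfloor>)) \<partial>unit_uniform) = ennreal ((1 / n) * (\<Sum>i<n. f i))"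
proof -
  have "(\<Sum>i<n. ennreal (1 / n) * ennreal (f i)) = (\<Sum>i<n. ennreal (1 / n * f i))"
    using f by (intro sum.cong refl) (auto simp: ennreal_mult'[symmetric])
  also have "\<dots> = ennreal (\<Sum>i<n. 1 / n * f i)"
    using f by (intro sum_ennreal) auto
  finally show ?thesis
    by (simp only: nn_integral_step[OF n, of "\<lambda>i. ennreal (f i)"] sum_distrib_left)
qed

lemma integral_empirical_measure:
  fixes f :: "real \<Rightarrow> real"
  assumes "f \<in> borel_measurable borel"
  shows "(\<integral>y. f y \<partial>empirical_measure n x) = (1 / n) * (\<Sum>i<n. f (x i))"
  unfolding empirical_measure_def using assms
  by (subst integral_distr) (simp_all add: integral_uniform_count_measure measurable_def
    sets_uniform_count_measure space_uniform_count_measure)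

text \<open>Joint measurability is what exchanging the integrals over \<open>\<omega>\<close> and
  \<open>u\<close> requires. The coordinate chosen by \<open>u\<close> is written as a finite sum
  over the cells, each term being a product of a function of \<open>\<omega>\<close> and a function
  of \<open>u\<close>.\<close>

lemma measurable_step_quantile:
  assumes n: "n \<ge> 1" and Z: "\<And>i. i < n \<Longrightarrow> (\<lambda>\<omega>. Z \<omega> i) \<in> borel_measurable P"
  shows "(\<lambda>(\<omega>, u). step_quantile n (Z \<omega>) u) \<in> borel_measurable (P \<Otimes>\<^sub>M unit_uniform)"
proof -
  let ?I = "\<lambda>i. {u\<in>{0<..<1}. nat \<lfloor>real n * u\<rfloor> = i}"
  have I: "?I i \<in> sets unit_uniform" for i
  proof -
    have "?I i \<in> sets borel" by measurable
    then show ?thesis by (subst sets_restrict_space_iff) auto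
  qed
  have "(\<lambda>(\<omega>, u). \<Sum>i<n. Z \<omega> i * indicator (?I i) u) \<in> borel_measurable (P \<Otimes>\<^sub>M unit_uniform)"
    unfolding split_beta'
  proof (intro borel_measurable_sum borel_measurable_times)
    fix i assume "i \<in> {..<n}"
    then show "(\<lambda>p. Z (fst p) i) \<in> borel_measurable (P \<Otimes>\<^sub>M unit_uniform)"
      using Z by (intro measurable_compose[OF measurable_fst]) auto
    show "(\<lambda>p. indicator (?I i) (snd p) :: real) \<in> borel_measurable (P \<Otimes>\<^sub>M unit_uniform)"
      using I by (intro measurable_compose[OF measurable_snd]) auto
  qed
  moreover have "(case p of (\<omega>, u) \<Rightarrow> step_quantile n (Z \<omega>) u)
      = (case p of (\<omega>, u) \<Rightarrow> \<Sum>i<n. Z \<omega> i * indicator (?I i) u)"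
    if "p \<in> space (P \<Otimes>\<^sub>M unit_uniform)" for p
  proof -
    obtain \<omega> u where p: "p = (\<omega>, u)" by (cases p)
    with that have u: "0 < u" "u < 1" by (auto simp: space_pair_measure)
    have "(\<Sum>i<n. Z \<omega> i * indicator (?I i) u) = (\<Sum>i<n. if i = nat \<lfloor>real n * u\<rfloor> then Z \<omega> i else 0)"
      using u by (intro sum.cong) (auto simp: indicator_def)
    also have "\<dots> = step_quantile n (Z \<omega>) u"
      using nat_floor_less[OF u n] by (simp add: step_quantile_def)
    finally show ?thesis using p by simp
  qed
  ultimately show ?thesis by (subst measurable_cong) auto
qed

lemma mono_on_step_quantile:
  assumes "n \<ge> 1" "mono_on {..<n} x"
  shows "mono_on {0<..<1} (step_quantile n x)"
proof (rule mono_onI)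
  fix u v :: real assume uv: "u \<in> {0<..<1}" "v \<in> {0<..<1}" "u \<le> v"
  then have "nat \<lfloor>real n * u\<rfloor> \<le> nat \<lfloor>real n * v\<rfloor>"
    by (intro nat_mono floor_mono mult_left_mono) auto
  then show "step_quantile n x u \<le> step_quantile n x v"
    using uv nat_floor_less[OF _ _ assms(1)] unfolding step_quantile_def
    by (intro mono_onD[OF assms(2)]) auto
qed

section \<open>The quantile function of a probability measure on the line\<close>

context
  fixes \<rho> :: "real measure"
  assumes \<rho>: "prob_space \<rho>" "sets \<rho> = sets borel"
begin

lemma real_distribution_of_prob: "real_distribution \<rho>"
  using \<rho> by (auto simp: real_distribution_def real_distribution_axioms_def sets_eq_imp_space_eq[OF \<rho>(2)])

interpretation cdf_distribution \<rho>
  by (simp add: cdf_distribution_def real_distribution_of_prob)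

lemma quantile_le_iff: "0 < u \<Longrightarrow> u < 1 \<Longrightarrow> quantile \<rho> u \<le> x \<longleftrightarrow> u \<le> cdf \<rho> x"
  unfolding quantile_def by (rule pseudoinverse[symmetric])

lemma measurable_quantile: "quantile \<rho> \<in> borel_measurable unit_uniform"
proof -
  have "quantile \<rho> \<in> borel_measurable (restrict_space borel {0<..<1})"
    unfolding quantile_def[abs_def] by (rule measurable_CI)
  then show ?thesis by (simp add: measurable_cong_sets[OF sets_restrict_space_cong[OF sets_lborel] refl])
qed

lemma distr_quantile: "distr unit_uniform borel (quantile \<rho>) = \<rho>"
  unfolding quantile_def[abs_def] by (rule distr_I_eq_M)

lemma AE_isCont_quantile: "AE u in unit_uniform. isCont (quantile \<rho>) u"
proof -
  have "countable {u\<in>{0<..<1}. \<not> isCont (quantile \<rho>) u}"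
    unfolding quantile_def[abs_def] by (intro mono_on_ctble_discont_open mono_I) simp
  from AE_unit_uniform_notin_countable[OF this] show ?thesis
    by (rule AE_mp) (auto intro!: AE_I2)
qed

text \<open>By continuity some \<open>v > u\<close> still has its quantile below
  \<open>quantile \<rho> u + \<eta>\<close>, which forces the distribution function there up to at
  least \<open>v\<close>. At a jump of the quantile function the distribution function may stay
  equal to \<open>u\<close> on an interval, and the strict gap would be lost.\<close>

lemma less_cdf_quantile_plus:
  assumes u: "0 < u" "u < 1" and cont: "isCont (quantile \<rho>) u" and \<eta>: "0 < \<eta>"
  shows "u < cdf \<rho> (quantile \<rho> u + \<eta>)"
proof -
  have "eventually (\<lambda>v. quantile \<rho> v < quantile \<rho> u + \<eta>) (at_right u)"
    using cont \<eta> by (intro order_tendstoD(2)[of "quantile \<rho>" "quantile \<rho> u"])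
      (auto simp: isCont_def intro: tendsto_within_subset)
  moreover have "eventually (\<lambda>v. v \<in> {u<..<1}) (at_right u)"
    using u by (auto simp: eventually_at_right)
  ultimately have "eventually (\<lambda>v. quantile \<rho> v < quantile \<rho> u + \<eta> \<and> v \<in> {u<..<1}) (at_right u)"
    by (rule eventually_conj)
  then obtain v where "quantile \<rho> v < quantile \<rho> u + \<eta>" "u < v" "v < 1"
    using eventually_happens'[OF trivial_limit_at_right_real] by auto
  then show ?thesis using quantile_le_iff[of v "quantile \<rho> u + \<eta>"] u by auto
qed

end

text \<open>The set where an increasing \<open>f\<close> is at most \<open>c\<close> is an initial
  segment of the unit interval, so it suffices to compare it with \<open>{0<..u}\<close>, which has
  mass \<open>u\<close>.\<close>

lemma cdf_distr_mono:
  assumes f: "f \<in> borel_measurable unit_uniform" "mono_on {0<..<1} f" and u: "0 < u" "u < 1"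
  shows "b < f u \<Longrightarrow> cdf (distr unit_uniform borel f) b \<le> u"
    and "f u < a \<Longrightarrow> u \<le> cdf (distr unit_uniform borel f) a"
proof -
  have cdf: "cdf (distr unit_uniform borel f) c = measure unit_uniform {v\<in>{0<..<1}. f v \<le> c}" for c
    using f by (auto simp: cdf_def measure_distr intro!: arg_cong[where f="measure _"])
  have sets: "{v\<in>{0<..<1}. f v \<le> c} \<in> sets unit_uniform" for c
    using measurable_sets[OF f(1), of "{..c}"] by (simp add: vimage_def Int_def conj_commute)
  have u_eq: "measure unit_uniform {0<..u} = u" "{0<..u} \<in> sets unit_uniform"
    using u by (auto simp: measure_restrict_space sets_restrict_space_iff subset_eq)
  show "cdf (distr unit_uniform borel f) b \<le> u" if b: "b < f u"
  proof -
    have "{v\<in>{0<..<1}. f v \<le> b} \<subseteq> {0<..u}"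
    proof safe
      fix v assume v: "v \<in> {0<..<1}" "f v \<le> b"
      then have "\<not> u \<le> v" using mono_onD[OF f(2), of u v] u b by auto
      then show "v \<in> {0<..u}" using v by auto
    qed
    from unit_uniform.finite_measure_mono[OF this] show ?thesis using u_eq cdf by simp
  qed
  show "u \<le> cdf (distr unit_uniform borel f) a" if a: "f u < a"
  proof -
    have "{0<..u} \<subseteq> {v\<in>{0<..<1}. f v \<le> a}"
    proof safe
      fix v assume v: "v \<in> {0<..u}"
      then show "f v \<le> a" using mono_onD[OF f(2), of v u] u a by auto
    qed (use u in auto)
    from unit_uniform.finite_measure_mono[OF this sets] show ?thesis using u_eq cdf by simp
  qed
qed

section \<open>The quantile coupling\<close>

text \<open>The square of the distance is kept, so that expectations act linearly and can be
  exchanged with the integral over \<open>u\<close>. The root reappears only through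
  \<open>ennreal_sqrt_le\<close>.\<close>

definition quantile_cost :: "(real \<Rightarrow> real) \<Rightarrow> (real \<Rightarrow> real) \<Rightarrow> ennreal" where
  "quantile_cost f g = (\<integral>\<^sup>+u. ennreal ((f u - g u)\<^sup>2) \<partial>unit_uniform)"

text \<open>Feeding one uniform variable into both functions gives a coupling of the two
  laws.\<close>

lemma W2_line_le_quantile_cost:
  assumes f: "f \<in> borel_measurable unit_uniform" and g: "g \<in> borel_measurable unit_uniform"
  shows "W2_line (distr unit_uniform borel f) (distr unit_uniform borel g) \<le> ennreal_sqrt (quantile_cost f g)"
proof -
  let ?\<mu> = "distr unit_uniform borel f" and ?\<nu> = "distr unit_uniform borel g"
  define \<pi> where "\<pi> = distr unit_uniform (borel \<Otimes>\<^sub>M borel) (\<lambda>u. (f u, g u))"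
  have fg: "(\<lambda>u. (f u, g u)) \<in> measurable unit_uniform (borel \<Otimes>\<^sub>M borel)"
    using f g by (rule measurable_Pair)
  have "\<pi> \<in> couplings ?\<mu> ?\<nu>"
    unfolding couplings_def mem_Collect_eq
  proof (intro conjI)
    show "prob_space \<pi>" unfolding \<pi>_def by (rule unit_uniform.prob_space_distr[OF fg])
    show "sets \<pi> = sets (?\<mu> \<Otimes>\<^sub>M ?\<nu>)"
      unfolding \<pi>_def sets_distr by (rule sets_pair_measure_cong[symmetric]) simp_all
    show "distr \<pi> ?\<mu> fst = ?\<mu>"
      unfolding \<pi>_def using f
      by (subst distr_distr[OF _ fg]) (auto simp: o_def measurable_distr_eq2 intro!: distr_cong)
    show "distr \<pi> ?\<nu> snd = ?\<nu>"
      unfolding \<pi>_def using g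
      by (subst distr_distr[OF _ fg]) (auto simp: o_def measurable_distr_eq2 intro!: distr_cong)
  qed
  moreover have "(\<integral>\<^sup>+ (x, y). ennreal ((dist x y)\<^sup>2) \<partial>\<pi>) = quantile_cost f g"
    unfolding \<pi>_def quantile_cost_def
    by (subst nn_integral_distr[OF fg]) (auto simp: dist_real_def)
  ultimately show ?thesis
    unfolding wasserstein2_def by (metis (no_types, lifting) INF_lower)
qed

text \<open>Either the root is at most \<open>\<kappa>\<close>, or it is at most \<open>x\<close>
  divided by \<open>\<kappa>\<close>. Being affine in \<open>x\<close>, the bound survives taking
  expectations and takes the place of Jensen's inequality.\<close>

lemma ennreal_sqrt_le:
  assumes \<kappa>: "0 < \<kappa>"
  shows "ennreal_sqrt x \<le> ennreal \<kappa> + ennreal (1 / \<kappa>) * x"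
proof (cases x)
  case (real y)
  have "sqrt y \<le> \<kappa> + 1 / \<kappa> * y"
  proof (cases "sqrt y \<le> \<kappa>")
    case False
    then have "sqrt y * \<kappa> \<le> sqrt y * sqrt y" using real by (intro mult_left_mono) auto
    then show ?thesis using real \<kappa> by (simp add: field_simps) (smt (verit) mult_nonneg_nonneg)
  qed (use real \<kappa> in \<open>auto intro: order_trans\<close>)
  then show ?thesis
    using real \<kappa> by (simp add: ennreal_sqrt_def flip: ennreal_mult' ennreal_plus)
next
  case top
  then show ?thesis using \<kappa> by (simp add: ennreal_mult_top)
qed

lemma quantile_cost_commute: "quantile_cost f g = quantile_cost g f"
  by (simp add: quantile_cost_def power2_commute)

lemma quantile_cost_triangle:
  assumes [measurable]: "f \<in> borel_measurable unit_uniform" "g \<in> borel_measurable unit_uniform"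
    "h \<in> borel_measurable unit_uniform" "k \<in> borel_measurable unit_uniform"
  shows "quantile_cost f k \<le> 3 * (quantile_cost f g + quantile_cost g h + quantile_cost h k)"
proof -
  have "quantile_cost f k \<le> (\<integral>\<^sup>+u. 3 * (ennreal ((f u - g u)\<^sup>2) + ennreal ((g u - h u)\<^sup>2)
      + ennreal ((h u - k u)\<^sup>2)) \<partial>unit_uniform)"
    unfolding quantile_cost_def
  proof (rule nn_integral_mono)
    fix u
    \<comment> \<open>The right side minus the left side is the sum of the squares of
      \<open>a - b\<close>, \<open>b - c\<close> and \<open>a - c\<close>.\<close>
    have *: "(a + b + c)\<^sup>2 \<le> 3 * (a\<^sup>2 + b\<^sup>2 + c\<^sup>2)" for a b c :: real
      using sum_squares_ge_zero[of "a - b" "b - c"] zero_le_power2[of "a - c"]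
      by (simp add: power2_eq_square algebra_simps)
    have "(f u - k u)\<^sup>2 \<le> 3 * ((f u - g u)\<^sup>2 + (g u - h u)\<^sup>2 + (h u - k u)\<^sup>2)"
      using *[of "f u - g u" "g u - h u" "h u - k u"] by simp
    then have "ennreal ((f u - k u)\<^sup>2) \<le> ennreal (3 * ((f u - g u)\<^sup>2 + (g u - h u)\<^sup>2 + (h u - k u)\<^sup>2))"
      by (rule ennreal_leI)
    then show "ennreal ((f u - k u)\<^sup>2) \<le> 3 * (ennreal ((f u - g u)\<^sup>2) + ennreal ((g u - h u)\<^sup>2)
        + ennreal ((h u - k u)\<^sup>2))"
      by (simp add: ennreal_mult' ennreal_plus)
  qed
  also have "\<dots> = 3 * (quantile_cost f g + quantile_cost g h + quantile_cost h k)"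
    unfolding quantile_cost_def by (simp add: nn_integral_cmult nn_integral_add)
  finally show ?thesis .
qed

lemma quantile_cost_step_quantile:
  assumes "n \<ge> 1"
  shows "quantile_cost (step_quantile n x) (step_quantile n y) = ennreal ((1 / n) * (\<Sum>i<n. (x i - y i)\<^sup>2))"
  unfolding quantile_cost_def step_quantile_def
  using nn_integral_step_real[OF assms, of "\<lambda>i. (x i - y i)\<^sup>2"] by simp

section \<open>Convergence at a fixed time\<close>

lemma continuous_on_cts_step:
  assumes "a < b"
  shows "continuous_on UNIV (cts_step a b)" "bounded (range (cts_step a b))"
    "cts_step a b \<in> borel_measurable borel"
proof -
  show c: "continuous_on UNIV (cts_step a b)"
    by (rule uniformly_continuous_imp_continuous[OF cts_step_uniformly_continuous[OF assms]])
  show "bounded (range (cts_step a b))"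
    using assms by (intro boundedI[of _ 1]) (auto simp: cts_step_def)
  show "cts_step a b \<in> borel_measurable borel"
    using c by (rule borel_measurable_continuous_onI)
qed

text \<open>Uniform integrability in pointwise form. On large deviations,
  \<open>z = (x - y)\<^sup>2\<close> satisfies \<open>R * z \<le> R * R + z * z\<close>, and
  \<open>z * z\<close> is controlled by fourth powers. A large \<open>R\<close> makes the moment
  term small; the remaining term only involves the size of the deviation set.\<close>

lemma square_le_split:
  fixes x y \<eta> R :: real
  assumes "0 < R"
  shows "(x - y)\<^sup>2 \<le> \<eta>\<^sup>2 + (R * (if \<eta> < \<bar>x - y\<bar> then 1 else 0) + 8 / R * (x ^ 4 + y ^ 4))"
proof (cases "\<eta> < \<bar>x - y\<bar>")
  case True
  have *: "(x - y) ^ 4 \<le> 8 * (x ^ 4 + y ^ 4)"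
  proof -
    have "(x - y)\<^sup>2 \<le> 2 * (x\<^sup>2 + y\<^sup>2)"
      using zero_le_power2[of "x + y"] by (simp add: power2_eq_square algebra_simps)
    then have "((x - y)\<^sup>2)\<^sup>2 \<le> (2 * (x\<^sup>2 + y\<^sup>2))\<^sup>2" by (rule power_mono) simp
    also have "\<dots> \<le> 8 * ((x\<^sup>2)\<^sup>2 + (y\<^sup>2)\<^sup>2)"
      using zero_le_power2[of "x\<^sup>2 - y\<^sup>2"] by (simp add: power2_eq_square algebra_simps)
    finally show ?thesis by (simp add: power_mult[symmetric])
  qed
  have "R * (x - y)\<^sup>2 \<le> R * R + (x - y) ^ 4"
  proof -
    have "R * z \<le> R * R + z * z" if "0 \<le> z" for z
    proof -
      have "2 * (R * z) \<le> R * R + z * z"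
        using zero_le_power2[of "R - z"] by (simp add: power2_eq_square algebra_simps)
      moreover have "0 \<le> R * z" using assms that by simp
      ultimately show ?thesis by linarith
    qed
    from this[of "(x - y)\<^sup>2"] show ?thesis by (simp add: power2_eq_square power4_eq_xxxx mult.assoc)
  qed
  also have "\<dots> \<le> R * R + 8 * (x ^ 4 + y ^ 4)" using * by simp
  finally have "(x - y)\<^sup>2 \<le> R + 8 / R * (x ^ 4 + y ^ 4)"
    using assms by (simp add: field_simps)
  then show ?thesis using True by (simp add: add_increasing)
next
  case False
  then have "\<bar>x - y\<bar>\<^sup>2 \<le> \<eta>\<^sup>2" by (intro power_mono) auto
  moreover have "0 \<le> 8 / R * (x ^ 4 + y ^ 4)" using assms by simp
  ultimately show ?thesis using False by simp
qed

text \<open>A snapshot at one time, with the dynamics forgotten. The conditions start at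
  \<open>n \<ge> 1\<close>, since the empirical measure of no particles has mass 0.\<close>

locale weak_chaos =
  fixes M :: "nat \<Rightarrow> 'a measure" and Y :: "nat \<Rightarrow> nat \<Rightarrow> 'a \<Rightarrow> real" and \<rho> :: "real measure" and C :: real
  assumes M: "\<And>n. n \<ge> 1 \<Longrightarrow> prob_space (M n)"
    and Y: "\<And>n i. n \<ge> 1 \<Longrightarrow> i < n \<Longrightarrow> Y n i \<in> borel_measurable (M n)"
    and ordered: "\<And>n. n \<ge> 1 \<Longrightarrow> AE \<omega> in M n. mono_on {..<n} (\<lambda>i. Y n i \<omega>)"
    and rho: "prob_space \<rho>" "sets \<rho> = sets borel"
    and weak: "weakly_converges_in_prob M (\<lambda>n \<omega>. empirical_measure n (\<lambda>i. Y n i \<omega>)) \<rho>"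
    and C: "0 \<le> C"
    and moment: "\<And>n. n \<ge> 1 \<Longrightarrow>
      (\<integral>\<^sup>+ \<omega>. ennreal ((1 / real n) * (\<Sum>i<n. \<bar>Y n i \<omega>\<bar> ^ 4)) \<partial>M n) \<le> ennreal C"
begin

abbreviation "q n \<omega> \<equiv> step_quantile n (\<lambda>i. Y n i \<omega>)"
abbreviation "r \<equiv> quantile \<rho>"

sublocale \<rho>: real_distribution \<rho>
  by (rule real_distribution_of_prob[OF rho])

lemma empirical_integral_measurable:
  fixes f :: "real \<Rightarrow> real"
  assumes "n \<ge> 1" "f \<in> borel_measurable borel"
  shows "(\<lambda>\<omega>. \<integral>y. f y \<partial>empirical_measure n (\<lambda>i. Y n i \<omega>)) \<in> borel_measurable (M n)"
  unfolding integral_empirical_measure[OF assms(2)]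
  using assms Y by (intro borel_measurable_times borel_measurable_sum measurable_compose[OF _ assms(2)]) auto

lemma test_function_deviation:
  fixes f :: "real \<Rightarrow> real"
  assumes f: "continuous_on UNIV f" "bounded (range f)" and \<gamma>: "0 < \<gamma>"
  shows "(\<lambda>n. measure (M n) {\<omega> \<in> space (M n).
    \<gamma> < \<bar>(\<integral>x. f x \<partial>empirical_measure n (\<lambda>i. Y n i \<omega>)) - (\<integral>x. f x \<partial>\<rho>)\<bar>}) \<longlonglongrightarrow> 0"
  using weak[unfolded weakly_converges_in_prob_def, rule_format, of f] f \<gamma>
  by (auto simp: vanishes_in_prob_def ennreal_less_iff)

lemma measurable_q: "n \<ge> 1 \<Longrightarrow> (\<lambda>(\<omega>, u). q n \<omega> u) \<in> borel_measurable (M n \<Otimes>\<^sub>M unit_uniform)"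
  using Y by (intro measurable_step_quantile) auto

lemma measurable_r: "(\<lambda>(\<omega>, u). r u) \<in> borel_measurable (M n \<Otimes>\<^sub>M unit_uniform)"
  using measurable_compose[OF measurable_snd measurable_quantile[OF rho]] by (simp add: split_beta')

lemma measurable_dist: "n \<ge> 1 \<Longrightarrow> (\<lambda>(\<omega>, u). \<bar>q n \<omega> u - r u\<bar>) \<in> borel_measurable (M n \<Otimes>\<^sub>M unit_uniform)"
  using borel_measurable_abs[OF borel_measurable_diff[OF measurable_q measurable_r]]
  by (simp add: split_beta')

text \<open>The integral of \<open>cts_step a b\<close> lies between the values of the distribution
  function at \<open>a\<close> and at \<open>b\<close>. If the empirical quantile exceeds
  \<open>r u + \<eta>\<close>, the first test function has empirical integral at most
  \<open>u\<close>, but integral at least \<open>cdf \<rho> (r u + \<eta> / 2)\<close>, which is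
  larger than \<open>u\<close>, under \<open>\<rho>\<close>. On the left the gap comes from
  \<open>quantile_le_iff\<close>. The thresholds are independent of \<open>n\<close> and
  \<open>x\<close>, as convergence in probability requires.\<close>

lemma quantile_deviation_bound:
  assumes u: "0 < u" "u < 1" and cont: "isCont r u" and \<eta>: "0 < \<eta>"
  obtains \<gamma>\<^sub>1 \<gamma>\<^sub>2 :: real where "0 < \<gamma>\<^sub>1" "0 < \<gamma>\<^sub>2"
    "\<And>n x. n \<ge> 1 \<Longrightarrow> mono_on {..<n} x \<Longrightarrow> \<eta> < \<bar>step_quantile n x u - r u\<bar> \<Longrightarrow>
      \<gamma>\<^sub>1 < \<bar>(\<integral>y. cts_step (r u + \<eta> / 2) (r u + \<eta>) y \<partial>empirical_measure n x)
        - (\<integral>y. cts_step (r u + \<eta> / 2) (r u + \<eta>) y \<partial>\<rho>)\<bar> \<or>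
      \<gamma>\<^sub>2 < \<bar>(\<integral>y. cts_step (r u - \<eta>) (r u - \<eta> / 2) y \<partial>empirical_measure n x)
        - (\<integral>y. cts_step (r u - \<eta>) (r u - \<eta> / 2) y \<partial>\<rho>)\<bar>"
proof
  let ?g1 = "cdf \<rho> (r u + \<eta> / 2) - u" and ?g2 = "u - cdf \<rho> (r u - \<eta> / 2)"
  have g1: "0 < ?g1"
    using less_cdf_quantile_plus[OF rho u cont, of "\<eta> / 2"] \<eta> by simp
  have g2: "0 < ?g2"
    using quantile_le_iff[OF rho u, of "r u - \<eta> / 2"] \<eta> by simp
  \<comment> \<open>Half of each gap is taken because the deviation of the integrals has to exceed
    the threshold strictly.\<close>
  show "0 < ?g1 / 2" "0 < ?g2 / 2" using g1 g2 by auto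
  fix n :: nat and x assume n: "n \<ge> 1" and x: "mono_on {..<n} x" and dev: "\<eta> < \<bar>step_quantile n x u - r u\<bar>"
  let ?\<mu> = "empirical_measure n x"
  have \<mu>: "?\<mu> = distr unit_uniform borel (step_quantile n x)"
    by (rule distr_step_quantile[OF n, symmetric])
  interpret \<mu>: real_distribution ?\<mu>
    unfolding \<mu> by (rule unit_uniform.real_distribution_distr[OF measurable_step_quantile_fixed[OF n]])
  have gap: "a \<le> u \<Longrightarrow> F \<le> b \<Longrightarrow> 0 < F - u \<Longrightarrow> (F - u) / 2 < \<bar>a - b\<bar>"
    "u \<le> a \<Longrightarrow> b \<le> F \<Longrightarrow> 0 < u - F \<Longrightarrow> (u - F) / 2 < \<bar>a - b\<bar>" for a b F :: real
    using abs_ge_minus_self[of "a - b"] abs_ge_self[of "a - b"] by simp_all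
  note cdf_\<mu> = cdf_distr_mono[OF measurable_step_quantile_fixed[OF n] mono_on_step_quantile[OF n x] u, folded \<mu>]
  show "?g1 / 2 < \<bar>(\<integral>y. cts_step (r u + \<eta> / 2) (r u + \<eta>) y \<partial>?\<mu>) - (\<integral>y. cts_step (r u + \<eta> / 2) (r u + \<eta>) y \<partial>\<rho>)\<bar> \<or>
      ?g2 / 2 < \<bar>(\<integral>y. cts_step (r u - \<eta>) (r u - \<eta> / 2) y \<partial>?\<mu>) - (\<integral>y. cts_step (r u - \<eta>) (r u - \<eta> / 2) y \<partial>\<rho>)\<bar>"
  proof (cases "r u + \<eta> < step_quantile n x u")
    case True
    have "(\<integral>y. cts_step (r u + \<eta> / 2) (r u + \<eta>) y \<partial>?\<mu>) \<le> cdf ?\<mu> (r u + \<eta>)"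
      using \<eta> by (intro \<mu>.cdf_cts_step) auto
    also have "\<dots> \<le> u" by (rule cdf_\<mu>(1)[OF True])
    finally have "(\<integral>y. cts_step (r u + \<eta> / 2) (r u + \<eta>) y \<partial>?\<mu>) \<le> u" .
    moreover have "cdf \<rho> (r u + \<eta> / 2) \<le> (\<integral>y. cts_step (r u + \<eta> / 2) (r u + \<eta>) y \<partial>\<rho>)"
      using \<eta> by (intro \<rho>.cdf_cts_step) auto
    ultimately show ?thesis using g1 by (intro disjI1 gap(1))
  next
    case False
    then have less: "step_quantile n x u < r u - \<eta>" using dev by linarith
    have "u \<le> cdf ?\<mu> (r u - \<eta>)" by (rule cdf_\<mu>(2)[OF less])
    also have "\<dots> \<le> (\<integral>y. cts_step (r u - \<eta>) (r u - \<eta> / 2) y \<partial>?\<mu>)"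
      using \<eta> by (intro \<mu>.cdf_cts_step) auto
    finally have "u \<le> (\<integral>y. cts_step (r u - \<eta>) (r u - \<eta> / 2) y \<partial>?\<mu>)" .
    moreover have "(\<integral>y. cts_step (r u - \<eta>) (r u - \<eta> / 2) y \<partial>\<rho>) \<le> cdf \<rho> (r u - \<eta> / 2)"
      using \<eta> by (intro \<rho>.cdf_cts_step) auto
    ultimately show ?thesis using g2 by (intro disjI2 gap(2))
  qed
qed

lemma quantile_deviation_in_prob:
  assumes u: "0 < u" "u < 1" and cont: "isCont r u" and \<eta>: "0 < \<eta>"
  shows "(\<lambda>n. measure (M n) {\<omega> \<in> space (M n). \<eta> < \<bar>q n \<omega> u - r u\<bar>}) \<longlonglongrightarrow> 0"
proof -
  let ?f1 = "cts_step (r u + \<eta> / 2) (r u + \<eta>)" and ?f2 = "cts_step (r u - \<eta>) (r u - \<eta> / 2)"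
  obtain \<gamma>\<^sub>1 \<gamma>\<^sub>2 :: real where \<gamma>: "0 < \<gamma>\<^sub>1" "0 < \<gamma>\<^sub>2"
    and dev: "\<And>n x. n \<ge> 1 \<Longrightarrow> mono_on {..<n} x \<Longrightarrow> \<eta> < \<bar>step_quantile n x u - r u\<bar> \<Longrightarrow>
      \<gamma>\<^sub>1 < \<bar>(\<integral>y. ?f1 y \<partial>empirical_measure n x) - (\<integral>y. ?f1 y \<partial>\<rho>)\<bar> \<or>
      \<gamma>\<^sub>2 < \<bar>(\<integral>y. ?f2 y \<partial>empirical_measure n x) - (\<integral>y. ?f2 y \<partial>\<rho>)\<bar>"
    using quantile_deviation_bound[OF assms] by blast
  define A where "A n f \<gamma> = {\<omega> \<in> space (M n). \<gamma> < \<bar>(\<integral>x. f x \<partial>empirical_measure n (\<lambda>i. Y n i \<omega>)) - (\<integral>x. f x \<partial>\<rho>)\<bar>}"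
    for n f and \<gamma> :: real
  have f1: "continuous_on UNIV ?f1" "bounded (range ?f1)" "?f1 \<in> borel_measurable borel"
    and f2: "continuous_on UNIV ?f2" "bounded (range ?f2)" "?f2 \<in> borel_measurable borel"
    using \<eta> by (intro continuous_on_cts_step; simp)+
  have lim: "(\<lambda>n. measure (M n) (A n ?f1 \<gamma>\<^sub>1) + measure (M n) (A n ?f2 \<gamma>\<^sub>2)) \<longlonglongrightarrow> 0 + 0"
    unfolding A_def by (intro tendsto_add test_function_deviation f1 f2 \<gamma>)
  have bound: "measure (M n) {\<omega> \<in> space (M n). \<eta> < \<bar>q n \<omega> u - r u\<bar>}
      \<le> measure (M n) (A n ?f1 \<gamma>\<^sub>1) + measure (M n) (A n ?f2 \<gamma>\<^sub>2)" if n: "n \<ge> 1" for n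
  proof -
    interpret Mn: prob_space "M n" by (rule M[OF n])
    have A_sets: "A n f \<gamma> \<in> sets (M n)" if "f \<in> borel_measurable borel" for f \<gamma>
    proof -
      note [measurable] = empirical_integral_measurable[OF n that]
      show ?thesis unfolding A_def by measurable
    qed
    \<comment> \<open>The particles are ordered only almost surely, hence an inclusion up to a null
      set.\<close>
    have "measure (M n) {\<omega> \<in> space (M n). \<eta> < \<bar>q n \<omega> u - r u\<bar>} \<le> measure (M n) (A n ?f1 \<gamma>\<^sub>1 \<union> A n ?f2 \<gamma>\<^sub>2)"
    proof (rule Mn.finite_measure_mono_AE)
      show "AE \<omega> in M n. \<omega> \<in> {\<omega> \<in> space (M n). \<eta> < \<bar>q n \<omega> u - r u\<bar>} \<longrightarrow> \<omega> \<in> A n ?f1 \<gamma>\<^sub>1 \<union> A n ?f2 \<gamma>\<^sub>2"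
        using ordered[OF n] by eventually_elim (use dev[OF n] in \<open>auto simp: A_def\<close>)
      show "A n ?f1 \<gamma>\<^sub>1 \<union> A n ?f2 \<gamma>\<^sub>2 \<in> sets (M n)"
        by (intro sets.Un A_sets f1 f2)
    qed
    also have "\<dots> \<le> measure (M n) (A n ?f1 \<gamma>\<^sub>1) + measure (M n) (A n ?f2 \<gamma>\<^sub>2)"
      by (intro measure_Un_le A_sets f1 f2)
    finally show ?thesis .
  qed
  show ?thesis
    by (rule tendsto_sandwich[OF _ _ tendsto_const lim[simplified]])
      (auto intro!: eventually_sequentiallyI[of 1] bound)
qed

lemma measurable_deviation:
  assumes n: "n \<ge> 1"
  shows "(\<lambda>(\<omega>, u). indicator {u. \<eta> < \<bar>q n \<omega> u - r u\<bar>} u :: ennreal)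
    \<in> borel_measurable (M n \<Otimes>\<^sub>M unit_uniform)"
proof -
  have "(\<lambda>p. indicator {\<eta><..} (case p of (\<omega>, u) \<Rightarrow> \<bar>q n \<omega> u - r u\<bar>) :: ennreal)
    \<in> borel_measurable (M n \<Otimes>\<^sub>M unit_uniform)"
    by (rule measurable_compose[OF measurable_dist[OF n]]) simp
  then show ?thesis by (simp add: split_beta' indicator_def)
qed

text \<open>Convergence in probability is known for almost every fixed \<open>u\<close>. Exchanging
  the integrals puts the probability inside, where it is bounded by 1 and dominated convergence over
  \<open>u\<close> applies.\<close>

lemma quantile_deviation_product_measure:
  assumes \<eta>: "0 < \<eta>"
  shows "(\<lambda>n. \<integral>\<^sup>+\<omega>. \<integral>\<^sup>+u. indicator {u. \<eta> < \<bar>q n \<omega> u - r u\<bar>} u \<partial>unit_uniform \<partial>M n) \<longlonglongrightarrow> 0"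
proof (rule LIMSEQ_imp_Suc)
  let ?P = "\<lambda>n u. emeasure (M n) {\<omega> \<in> space (M n). \<eta> < \<bar>q n \<omega> u - r u\<bar>}"
  note ind = measurable_deviation
  have slice: "(\<integral>\<^sup>+\<omega>. indicator {u. \<eta> < \<bar>q n \<omega> u - r u\<bar>} u \<partial>M n) = ?P n u"
    if n: "n \<ge> 1" and u: "u \<in> {0<..<1}" for n u
  proof -
    have "(\<lambda>\<omega>. \<bar>q n \<omega> u - r u\<bar>) \<in> borel_measurable (M n)"
      using measurable_compose[OF measurable_Pair2'[of u unit_uniform "M n"] measurable_dist[OF n]] u
      by simp
    then have "{\<omega> \<in> space (M n). \<eta> < \<bar>q n \<omega> u - r u\<bar>} \<in> sets (M n)" by measurable
    then have "?P n u = (\<integral>\<^sup>+\<omega>. indicator {\<omega> \<in> space (M n). \<eta> < \<bar>q n \<omega> u - r u\<bar>} \<omega> \<partial>M n)" by simp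
    also have "\<dots> = (\<integral>\<^sup>+\<omega>. indicator {u. \<eta> < \<bar>q n \<omega> u - r u\<bar>} u \<partial>M n)"
      by (intro nn_integral_cong) (auto simp: indicator_def)
    finally show ?thesis by simp
  qed
  have Fubini: "(\<integral>\<^sup>+\<omega>. \<integral>\<^sup>+u. indicator {u. \<eta> < \<bar>q n \<omega> u - r u\<bar>} u \<partial>unit_uniform \<partial>M n)
      = (\<integral>\<^sup>+u. ?P n u \<partial>unit_uniform)"
    and P_meas: "?P n \<in> borel_measurable unit_uniform" if n: "n \<ge> 1" for n
  proof -
    interpret Mn: prob_space "M n" by (rule M[OF n])
    interpret pair_sigma_finite "M n" unit_uniform ..
    have "(\<integral>\<^sup>+u. \<integral>\<^sup>+\<omega>. indicator {u. \<eta> < \<bar>q n \<omega> u - r u\<bar>} u \<partial>M n \<partial>unit_uniform)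
        = (\<integral>\<^sup>+\<omega>. \<integral>\<^sup>+u. indicator {u. \<eta> < \<bar>q n \<omega> u - r u\<bar>} u \<partial>unit_uniform \<partial>M n)"
      by (rule Fubini'[OF ind[OF n]])
    moreover have "(\<integral>\<^sup>+u. \<integral>\<^sup>+\<omega>. indicator {u. \<eta> < \<bar>q n \<omega> u - r u\<bar>} u \<partial>M n \<partial>unit_uniform)
        = (\<integral>\<^sup>+u. ?P n u \<partial>unit_uniform)"
      using slice[OF n] by (intro nn_integral_cong) simp
    ultimately show "(\<integral>\<^sup>+\<omega>. \<integral>\<^sup>+u. indicator {u. \<eta> < \<bar>q n \<omega> u - r u\<bar>} u \<partial>unit_uniform \<partial>M n)
      = (\<integral>\<^sup>+u. ?P n u \<partial>unit_uniform)" by simp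
    have "(\<lambda>(u, \<omega>). indicator {u. \<eta> < \<bar>q n \<omega> u - r u\<bar>} u :: ennreal)
      \<in> borel_measurable (unit_uniform \<Otimes>\<^sub>M M n)"
      using measurable_pair_swap[OF ind[OF n]] by simp
    then have "(\<lambda>u. \<integral>\<^sup>+\<omega>. indicator {u. \<eta> < \<bar>q n \<omega> u - r u\<bar>} u \<partial>M n) \<in> borel_measurable unit_uniform"
      by (rule Mn.borel_measurable_nn_integral)
    then show "?P n \<in> borel_measurable unit_uniform"
      using slice[OF n] by (subst measurable_cong) auto
  qed
  \<comment> \<open>The index is shifted by one because measurability and the bound must hold for
    every member of the sequence, while the data are controlled from one particle on.\<close>
  have "(\<lambda>n. \<integral>\<^sup>+u. ?P (Suc n) u \<partial>unit_uniform) \<longlonglongrightarrow> (\<integral>\<^sup>+u. 0 \<partial>unit_uniform)"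
  proof (rule nn_integral_dominated_convergence[where w="\<lambda>_. 1"])
    show "?P (Suc n) \<in> borel_measurable unit_uniform" for n by (rule P_meas) simp
    show "AE u in unit_uniform. ?P (Suc n) u \<le> 1" for n
    proof -
      interpret Mn: prob_space "M (Suc n)" by (rule M) simp
      show ?thesis by (simp add: Mn.emeasure_le_1)
    qed
    show "AE u in unit_uniform. (\<lambda>n. ?P (Suc n) u) \<longlonglongrightarrow> 0"
    proof (rule AE_mp[OF AE_isCont_quantile[OF rho]], rule AE_I2, rule impI)
      fix u assume u: "u \<in> space unit_uniform" "isCont r u"
      have "(\<lambda>n. ennreal (measure (M (Suc n)) {\<omega> \<in> space (M (Suc n)). \<eta> < \<bar>q (Suc n) \<omega> u - r u\<bar>})) \<longlonglongrightarrow> ennreal 0"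
        using u \<eta> by (intro tendsto_ennrealI LIMSEQ_Suc[OF quantile_deviation_in_prob]) auto
      moreover have "ennreal (measure (M (Suc n)) A) = emeasure (M (Suc n)) A" for n A
      proof -
        interpret Mn: prob_space "M (Suc n)" by (rule M) simp
        show ?thesis by (rule Mn.emeasure_eq_measure[symmetric])
      qed
      ultimately show "(\<lambda>n. ?P (Suc n) u) \<longlonglongrightarrow> 0" by simp
    qed
  qed (use unit_uniform.emeasure_space_1 in auto)
  then show "(\<lambda>n. \<integral>\<^sup>+\<omega>. \<integral>\<^sup>+u. indicator {u. \<eta> < \<bar>q (Suc n) \<omega> u - r u\<bar>} u \<partial>unit_uniform \<partial>M (Suc n)) \<longlonglongrightarrow> 0"
    by (simp add: Fubini)
qed

text \<open>Lower semicontinuity of moments under weak convergence: the truncated power is a bounded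
  continuous test function, and its empirical average is at most the empirical fourth moment, whose
  expectation is bounded by \<open>C\<close>.\<close>

lemma truncated_moment_le:
  fixes K :: nat
  shows "(\<integral>x. min (x ^ 4) (real K) \<partial>\<rho>) \<le> C"
proof (rule field_le_epsilon)
  fix \<epsilon> :: real assume "0 < \<epsilon>"
  \<comment> \<open>One half of \<open>\<epsilon>\<close> pays for the deviation of the test
    integral, the other for the event \<open>A n\<close> where this deviation is large, weighted by
    \<open>real K\<close>.\<close>
  define \<eta> where "\<eta> = \<epsilon> / 2"
  have \<eta>: "0 < \<eta>" using \<open>0 < \<epsilon>\<close> by (simp add: \<eta>_def)
  define g where "g x = min (x ^ 4) (real K)" for x :: real
  have g: "continuous_on UNIV g" "bounded (range g)" "g \<in> borel_measurable borel"
  proof -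
    show "continuous_on UNIV g" unfolding g_def by (intro continuous_intros)
    then show "g \<in> borel_measurable borel" by (rule borel_measurable_continuous_onI)
    show "bounded (range g)" by (rule boundedI[of _ "real K"]) (auto simp: g_def)
  qed
  define a where "a = (\<integral>x. g x \<partial>\<rho>)"
  have a: "a \<le> real K"
  proof -
    have "a \<le> (\<integral>x. real K \<partial>\<rho>)"
      unfolding a_def using g(3)
      by (intro integral_mono \<rho>.integrable_const_bound[where B="real K"]) (auto simp: g_def)
    then show ?thesis using \<rho>.prob_space by simp
  qed
  define Z where "Z n \<omega> = (\<integral>x. g x \<partial>empirical_measure n (\<lambda>i. Y n i \<omega>))" for n \<omega>
  define A where "A n = {\<omega> \<in> space (M n). \<eta> < \<bar>Z n \<omega> - a\<bar>}" for n
  have "(\<lambda>n. measure (M n) (A n)) \<longlonglongrightarrow> 0"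
    unfolding A_def Z_def a_def by (rule test_function_deviation[OF g(1,2) \<eta>])
  then have "(\<lambda>n. real K * measure (M n) (A n)) \<longlonglongrightarrow> 0" by (rule tendsto_mult_right_zero)
  then have "eventually (\<lambda>n. real K * measure (M n) (A n) < \<eta> \<and> n \<ge> 1) sequentially"
    by (intro eventually_conj order_tendstoD(2)[OF _ \<eta>] eventually_ge_at_top)
  then obtain n where n: "real K * measure (M n) (A n) < \<eta>" "n \<ge> 1"
    using eventually_happens'[OF sequentially_bot] by blast
  interpret Mn: prob_space "M n" by (rule M[OF n(2)])
  have Zm: "Z n \<in> borel_measurable (M n)"
    unfolding Z_def[abs_def] by (rule empirical_integral_measurable[OF n(2) g(3)])
  have A_sets: "A n \<in> sets (M n)" unfolding A_def using Zm by measurable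
  let ?S = "\<lambda>\<omega>. (1 / real n) * (\<Sum>i<n. \<bar>Y n i \<omega>\<bar> ^ 4)"
  have S_meas: "?S \<in> borel_measurable (M n)"
    using Y[OF n(2)] by (intro borel_measurable_times borel_measurable_sum borel_measurable_power borel_measurable_abs) auto
  have "Z n \<omega> \<le> ?S \<omega>" for \<omega>
    unfolding Z_def integral_empirical_measure[OF g(3)]
    by (intro mult_left_mono sum_mono) (auto simp: g_def)
  \<comment> \<open>On \<open>A n\<close> the bound \<open>a \<le> real K\<close> is used; elsewhere
    \<open>a\<close> exceeds the empirical average by at most \<open>\<eta>\<close>.\<close>
  then have point: "a \<le> ?S \<omega> + (\<eta> + real K * indicator (A n) \<omega>)" if "\<omega> \<in> space (M n)" for \<omega>
  proof (cases "\<omega> \<in> A n")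
    case True
    have "0 \<le> ?S \<omega>" by (simp add: sum_nonneg)
    then show ?thesis using True a \<eta> by simp
  next
    case False
    then have "\<bar>Z n \<omega> - a\<bar> \<le> \<eta>" using that by (simp add: A_def)
    then have "a \<le> Z n \<omega> + \<eta>" by (simp add: abs_le_iff)
    also have "\<dots> \<le> ?S \<omega> + \<eta>" using \<open>Z n \<omega> \<le> ?S \<omega>\<close> by (rule add_right_mono)
    finally show ?thesis using False by simp
  qed
  have "ennreal a = (\<integral>\<^sup>+\<omega>. ennreal a \<partial>M n)" by (simp add: Mn.emeasure_space_1)
  also have "\<dots> \<le> (\<integral>\<^sup>+\<omega>. ennreal (?S \<omega>) + (ennreal \<eta> + ennreal (real K) * indicator (A n) \<omega>) \<partial>M n)"
  proof (rule nn_integral_mono)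
    fix \<omega> assume "\<omega> \<in> space (M n)"
    from point[OF this] have "ennreal a \<le> ennreal (?S \<omega> + (\<eta> + real K * indicator (A n) \<omega>))"
      by (rule ennreal_leI)
    also have "\<dots> = ennreal (?S \<omega>) + (ennreal \<eta> + ennreal (real K) * indicator (A n) \<omega>)"
      using \<eta> by (simp add: ennreal_plus sum_nonneg ennreal_mult ennreal_indicator)
    finally show "ennreal a \<le> ennreal (?S \<omega>) + (ennreal \<eta> + ennreal (real K) * indicator (A n) \<omega>)" .
  qed
  also have "\<dots> = (\<integral>\<^sup>+\<omega>. ennreal (?S \<omega>) \<partial>M n) + (ennreal \<eta> + ennreal (real K) * emeasure (M n) (A n))"
    using S_meas A_sets by (simp add: nn_integral_add nn_integral_cmult Mn.emeasure_space_1)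
  also have "\<dots> \<le> ennreal C + (ennreal \<eta> + ennreal (real K) * ennreal (measure (M n) (A n)))"
    using moment[OF n(2)] by (intro add_mono) (simp_all add: Mn.emeasure_eq_measure)
  also have "\<dots> = ennreal (C + (\<eta> + real K * measure (M n) (A n)))"
    using C \<eta> by (simp add: ennreal_plus ennreal_mult)
  finally have "a \<le> C + (\<eta> + real K * measure (M n) (A n))"
    using C \<eta> by (subst (asm) ennreal_le_iff) auto
  also have "\<dots> \<le> C + \<epsilon>" using n(1) by (simp add: \<eta>_def)
  finally show "(\<integral>x. min (x ^ 4) (real K) \<partial>\<rho>) \<le> C + \<epsilon>" by (simp add: a_def g_def)
qed

lemma fourth_moment_le: "(\<integral>\<^sup>+x. ennreal (x ^ 4) \<partial>\<rho>) \<le> ennreal C"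
proof -
  have "(\<integral>\<^sup>+x. ennreal (x ^ 4) \<partial>\<rho>) \<le> (\<integral>\<^sup>+x. (SUP K. ennreal (min (x ^ 4) (real K))) \<partial>\<rho>)"
  proof (rule nn_integral_mono)
    fix x
    show "ennreal (x ^ 4) \<le> (SUP K. ennreal (min (x ^ 4) (real K)))"
      by (rule SUP_upper2[of "nat \<lceil>x ^ 4\<rceil>"]) (auto simp: min_absorb1 real_nat_ceiling_ge)
  qed
  also have "\<dots> = (SUP K. \<integral>\<^sup>+x. ennreal (min (x ^ 4) (real K)) \<partial>\<rho>)"
    by (rule nn_integral_monotone_convergence_SUP)
      (auto simp: incseq_def le_fun_def intro!: ennreal_leI min.mono)
  also have "\<dots> \<le> ennreal C"
  proof (rule SUP_least)
    fix K
    have "(\<integral>\<^sup>+x. ennreal (min (x ^ 4) (real K)) \<partial>\<rho>) = ennreal (\<integral>x. min (x ^ 4) (real K) \<partial>\<rho>)"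
      by (intro nn_integral_eq_integral \<rho>.integrable_const_bound[where B="real K"]) auto
    then show "(\<integral>\<^sup>+x. ennreal (min (x ^ 4) (real K)) \<partial>\<rho>) \<le> ennreal C"
      using ennreal_leI[OF truncated_moment_le] by simp
  qed
  finally show ?thesis .
qed

lemma expected_quantile_cost_small:
  assumes e: "0 < e"
  obtains N where "\<And>n. n \<ge> N \<Longrightarrow> (\<integral>\<^sup>+\<omega>. quantile_cost (q n \<omega>) r \<partial>M n) \<le> ennreal e"
proof -
  \<comment> \<open>Each of the three terms of \<open>square_le_split\<close> gets
    \<open>e / 3\<close>: \<open>\<eta>\<close> fixes the first, \<open>R\<close> makes the moment
    term \<open>8 / R * (C + C)\<close> small enough, and only then is \<open>n\<close> chosen to
    make \<open>R\<close> times the deviation measure small. The summand 1 keeps \<open>R\<close>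
    positive when \<open>C\<close> is 0.\<close>
  define \<eta> where "\<eta> = sqrt (e / 3)"
  define R where "R = 1 + 48 * C / e"
  have \<eta>: "0 < \<eta>" "\<eta>\<^sup>2 = e / 3" using e by (auto simp: \<eta>_def)
  have R: "0 < R" "16 * C / R \<le> e / 3"
  proof -
    show "0 < R" using e C by (simp add: R_def add_pos_nonneg)
    moreover have "48 * C \<le> e * R" using e by (simp add: R_def distrib_left)
    ultimately show "16 * C / R \<le> e / 3" by (simp add: field_simps)
  qed
  let ?I = "\<lambda>n \<omega>. \<integral>\<^sup>+u. indicator {u. \<eta> < \<bar>q n \<omega> u - r u\<bar>} u \<partial>unit_uniform"
  have "eventually (\<lambda>n. (\<integral>\<^sup>+\<omega>. ?I n \<omega> \<partial>M n) < ennreal (e / (3 * R)) \<and> n \<ge> 1) sequentially"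
    using e R(1) by (intro eventually_conj order_tendstoD(2)[OF quantile_deviation_product_measure[OF \<eta>(1)]]
      eventually_ge_at_top) simp
  then obtain N where N: "\<And>n. n \<ge> N \<Longrightarrow> (\<integral>\<^sup>+\<omega>. ?I n \<omega> \<partial>M n) < ennreal (e / (3 * R)) \<and> n \<ge> 1"
    unfolding eventually_sequentially by blast
  have r4: "(\<integral>\<^sup>+u. ennreal (r u ^ 4) \<partial>unit_uniform) \<le> ennreal C"
    using fourth_moment_le nn_integral_distr[OF measurable_quantile[OF rho], of "\<lambda>x. ennreal (x ^ 4)"]
    by (simp add: distr_quantile[OF rho])
  have "(\<integral>\<^sup>+\<omega>. quantile_cost (q n \<omega>) r \<partial>M n) \<le> ennreal e" if "n \<ge> N" for n
  proof -
    have n: "n \<ge> 1" and small: "(\<integral>\<^sup>+\<omega>. ?I n \<omega> \<partial>M n) \<le> ennreal (e / (3 * R))"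
      using N[OF that] by auto
    interpret Mn: prob_space "M n" by (rule M[OF n])
    let ?S = "\<lambda>\<omega>. (1 / real n) * (\<Sum>i<n. \<bar>Y n i \<omega>\<bar> ^ 4)"
    have S_meas: "?S \<in> borel_measurable (M n)"
      using Y[OF n] by (intro borel_measurable_times borel_measurable_sum borel_measurable_power borel_measurable_abs) auto
    have I_meas: "?I n \<in> borel_measurable (M n)"
      using unit_uniform.borel_measurable_nn_integral[OF measurable_deviation[OF n]] by simp
    have inner: "quantile_cost (q n \<omega>) r \<le> ennreal (e / 3) + (ennreal R * ?I n \<omega>
        + ennreal (8 / R) * (ennreal (?S \<omega>) + ennreal C))" for \<omega>
    proof -
      have [measurable]: "q n \<omega> \<in> borel_measurable unit_uniform" "r \<in> borel_measurable unit_uniform"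
        by (rule measurable_step_quantile_fixed[OF n], rule measurable_quantile[OF rho])
      have [measurable]: "(\<lambda>u. indicator {u. \<eta> < \<bar>q n \<omega> u - r u\<bar>} u :: ennreal) \<in> borel_measurable unit_uniform"
      proof -
        have "(\<lambda>u. if \<eta> < \<bar>q n \<omega> u - r u\<bar> then 1 else 0 :: ennreal) \<in> borel_measurable unit_uniform"
          by measurable
        then show ?thesis by (simp add: indicator_def)
      qed
      have "quantile_cost (q n \<omega>) r \<le> (\<integral>\<^sup>+u. ennreal (e / 3) + (ennreal R * indicator {u. \<eta> < \<bar>q n \<omega> u - r u\<bar>} u
          + ennreal (8 / R) * (ennreal (q n \<omega> u ^ 4) + ennreal (r u ^ 4))) \<partial>unit_uniform)"
        unfolding quantile_cost_def
      proof (rule nn_integral_mono)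
        fix u
        have "ennreal ((q n \<omega> u - r u)\<^sup>2) \<le> ennreal (e / 3 + (R * (if \<eta> < \<bar>q n \<omega> u - r u\<bar> then 1 else 0)
            + 8 / R * (q n \<omega> u ^ 4 + r u ^ 4)))"
          using square_le_split[OF R(1), of "q n \<omega> u" "r u" \<eta>] unfolding \<eta>(2) by (rule ennreal_leI)
        also have "\<dots> = ennreal (e / 3) + (ennreal (R * (if \<eta> < \<bar>q n \<omega> u - r u\<bar> then 1 else 0))
            + ennreal (8 / R * (q n \<omega> u ^ 4 + r u ^ 4)))"
          using e R(1) by (subst ennreal_plus ennreal_plus[symmetric]; simp)+
        also have "ennreal (8 / R * (q n \<omega> u ^ 4 + r u ^ 4)) = ennreal (8 / R) * (ennreal (q n \<omega> u ^ 4) + ennreal (r u ^ 4))"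
          using R(1) by (subst ennreal_mult) (auto simp: ennreal_plus)
        also have "ennreal (R * (if \<eta> < \<bar>q n \<omega> u - r u\<bar> then 1 else 0)) = ennreal R * indicator {u. \<eta> < \<bar>q n \<omega> u - r u\<bar>} u"
          by simp
        finally show "ennreal ((q n \<omega> u - r u)\<^sup>2) \<le> ennreal (e / 3) + (ennreal R * indicator {u. \<eta> < \<bar>q n \<omega> u - r u\<bar>} u
          + ennreal (8 / R) * (ennreal (q n \<omega> u ^ 4) + ennreal (r u ^ 4)))" .
      qed
      also have "\<dots> = ennreal (e / 3) + (ennreal R * ?I n \<omega> + ennreal (8 / R) *
          ((\<integral>\<^sup>+u. ennreal (q n \<omega> u ^ 4) \<partial>unit_uniform) + (\<integral>\<^sup>+u. ennreal (r u ^ 4) \<partial>unit_uniform)))"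
        using unit_uniform.emeasure_space_1
        by (simp add: nn_integral_add nn_integral_cmult del: space_unit_uniform nn_integral_indicator)
      also have "(\<integral>\<^sup>+u. ennreal (q n \<omega> u ^ 4) \<partial>unit_uniform) = ennreal (?S \<omega>)"
        using nn_integral_step_real[OF n, of "\<lambda>i. Y n i \<omega> ^ 4"] by (simp add: step_quantile_def)
      finally show ?thesis
        using r4 by (auto elim!: order_trans intro!: add_mono mult_left_mono)
    qed
    have "(\<integral>\<^sup>+\<omega>. quantile_cost (q n \<omega>) r \<partial>M n) \<le> (\<integral>\<^sup>+\<omega>. ennreal (e / 3) + (ennreal R * ?I n \<omega>
        + ennreal (8 / R) * (ennreal (?S \<omega>) + ennreal C)) \<partial>M n)"
      by (rule nn_integral_mono) (rule inner)
    also have "\<dots> = ennreal (e / 3) + (ennreal R * (\<integral>\<^sup>+\<omega>. ?I n \<omega> \<partial>M n)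
        + ennreal (8 / R) * ((\<integral>\<^sup>+\<omega>. ennreal (?S \<omega>) \<partial>M n) + ennreal C))"
      using S_meas I_meas
      by (simp add: nn_integral_add nn_integral_cmult Mn.emeasure_space_1 del: nn_integral_indicator)
    also have "\<dots> \<le> ennreal (e / 3) + (ennreal R * ennreal (e / (3 * R))
        + ennreal (8 / R) * (ennreal C + ennreal C))"
      using small moment[OF n] by (intro add_mono mult_left_mono) auto
    also have "\<dots> = ennreal (e / 3 + (R * (e / (3 * R)) + 8 / R * (C + C)))"
      using e R(1) C by (simp add: ennreal_plus[symmetric] ennreal_mult[symmetric] del: ennreal_plus)
    also have "\<dots> \<le> ennreal e"
      using e R by (intro ennreal_leI) simp
    finally show ?thesis .
  qed
  then show ?thesis by (rule that)
qed

end

section \<open>Couplings of configuration laws\<close>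

abbreviation config_space :: "nat \<Rightarrow> (nat \<Rightarrow> real) measure" where
  "config_space n \<equiv> PiM {..<n} (\<lambda>_. borel)"

lemma ennreal_sqrt_leI:
  assumes "x \<le> ennreal y" "0 \<le> y"
  shows "ennreal_sqrt x \<le> ennreal (sqrt y)"
proof (cases x)
  case (real z)
  then show ?thesis using assms by (simp add: ennreal_sqrt_def)
qed (use assms in \<open>auto simp: top_unique\<close>)

lemma ennreal_sqrt_lessD:
  assumes "ennreal_sqrt x < ennreal (sqrt y)" "0 \<le> y"
  shows "x \<le> ennreal y"
proof (cases x)
  case (real z)
  then show ?thesis using assms by (simp add: ennreal_sqrt_def ennreal_less_iff)
qed (use assms in \<open>auto simp: ennreal_sqrt_def\<close>)

lemma L2_set_power2: "(L2_set f A)\<^sup>2 = (\<Sum>i\<in>A. (f i)\<^sup>2)"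
  by (simp add: L2_set_def sum_nonneg)

lemma measurable_config:
  assumes "\<And>i. i < n \<Longrightarrow> X i t \<in> borel_measurable M"
  shows "(\<lambda>\<omega>. \<lambda>i\<in>{..<n}. X i t \<omega>) \<in> measurable M (config_space n)"
  using assms by (intro measurable_restrict) auto

lemma measurable_config_coordinate:
  assumes "i < n"
  shows "(\<lambda>x. x i) \<in> borel_measurable (config_space n)"
  using assms by (intro measurable_component_singleton) auto

lemma measurable_config_sqdist:
  "(\<lambda>p. \<Sum>i<n. (fst p i - snd p i)\<^sup>2) \<in> borel_measurable (config_space n \<Otimes>\<^sub>M config_space n)"
  by (intro borel_measurable_sum borel_measurable_power borel_measurable_diff
    measurable_compose[OF measurable_fst measurable_config_coordinate]
    measurable_compose[OF measurable_snd measurable_config_coordinate]) auto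

text \<open>Two times of the same trajectory are defined on one probability space, so their joint
  law is a coupling.\<close>

lemma W2_config_config_law_le:
  assumes "prob_space M" and Xs: "\<And>i. i < n \<Longrightarrow> X i s \<in> borel_measurable M"
    and Xt: "\<And>i. i < n \<Longrightarrow> X i t \<in> borel_measurable M"
  shows "W2_config n (config_law M n X s) (config_law M n X t)
    \<le> ennreal_sqrt (\<integral>\<^sup>+\<omega>. ennreal (\<Sum>i<n. (X i s \<omega> - X i t \<omega>)\<^sup>2) \<partial>M)"
proof -
  interpret prob_space M by fact
  let ?\<mu> = "config_law M n X s" and ?\<nu> = "config_law M n X t"
  let ?f = "\<lambda>\<omega>. \<lambda>i\<in>{..<n}. X i s \<omega>" and ?g = "\<lambda>\<omega>. \<lambda>i\<in>{..<n}. X i t \<omega>"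
  have f: "?f \<in> measurable M (config_space n)" and g: "?g \<in> measurable M (config_space n)"
    using measurable_config[of n X s M] measurable_config[of n X t M] Xs Xt by auto
  define \<pi> where "\<pi> = distr M (config_space n \<Otimes>\<^sub>M config_space n) (\<lambda>\<omega>. (?f \<omega>, ?g \<omega>))"
  have fg: "(\<lambda>\<omega>. (?f \<omega>, ?g \<omega>)) \<in> measurable M (config_space n \<Otimes>\<^sub>M config_space n)"
    using f g by (rule measurable_Pair)
  have "\<pi> \<in> couplings ?\<mu> ?\<nu>"
    unfolding couplings_def mem_Collect_eq
  proof (intro conjI)
    show "prob_space \<pi>" unfolding \<pi>_def by (rule prob_space_distr[OF fg])
    show "sets \<pi> = sets (?\<mu> \<Otimes>\<^sub>M ?\<nu>)"
      unfolding \<pi>_def config_law_def sets_distr by (rule sets_pair_measure_cong[symmetric]) simp_all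
    show "distr \<pi> ?\<mu> fst = ?\<mu>"
      unfolding \<pi>_def config_law_def
      by (subst distr_distr[OF _ fg]) (auto simp: o_def measurable_distr_eq2 intro!: distr_cong)
    show "distr \<pi> ?\<nu> snd = ?\<nu>"
      unfolding \<pi>_def config_law_def
      by (subst distr_distr[OF _ fg]) (auto simp: o_def measurable_distr_eq2 intro!: distr_cong)
  qed
  moreover have "(\<integral>\<^sup>+ (x, y). ennreal ((L2_set (\<lambda>i. x i - y i) {..<n})\<^sup>2) \<partial>\<pi>)
      = (\<integral>\<^sup>+\<omega>. ennreal (\<Sum>i<n. (X i s \<omega> - X i t \<omega>)\<^sup>2) \<partial>M)"
    unfolding \<pi>_def L2_set_power2 split_beta'
    using measurable_config_sqdist[of n] by (subst nn_integral_distr[OF fg]) auto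
  ultimately show ?thesis
    unfolding wasserstein2_def by (metis (no_types, lifting) INF_lower)
qed

text \<open>The factor \<open>real n\<close> makes \<open>c\<close> a squared distance per particle.
  An actual coupling is recorded, not just a distance, because later estimates integrate against
  it.\<close>

definition config_close :: "nat \<Rightarrow> real \<Rightarrow> (nat \<Rightarrow> real) measure \<Rightarrow> (nat \<Rightarrow> real) measure \<Rightarrow> bool" where
  "config_close n c \<mu> \<nu> \<longleftrightarrow> (\<exists>\<pi>\<in>couplings \<mu> \<nu>.
     (\<integral>\<^sup>+p. ennreal (\<Sum>i<n. (fst p i - snd p i)\<^sup>2) \<partial>\<pi>) \<le> ennreal (real n * c))"

text \<open>A strict bound on the infimum supplies a coupling below it, so no optimal coupling has
  to exist.\<close>

lemma config_close_if_W2: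
  assumes "W2_config n \<mu> \<nu> < ennreal (sqrt (real n * c))" "0 \<le> c"
  shows "config_close n c \<mu> \<nu>"
proof -
  obtain \<pi> where \<pi>: "\<pi> \<in> couplings \<mu> \<nu>"
    "ennreal_sqrt (\<integral>\<^sup>+ (x, y). ennreal ((L2_set (\<lambda>i. x i - y i) {..<n})\<^sup>2) \<partial>\<pi>) < ennreal (sqrt (real n * c))"
    using assms(1) unfolding wasserstein2_def INF_less_iff by blast
  from ennreal_sqrt_lessD[OF \<pi>(2)] assms(2) \<pi>(1) show ?thesis
    unfolding config_close_def by (auto simp: L2_set_power2 split_beta')
qed

text \<open>Expressed through the law of the configuration alone, because couplings of two such laws
  live on a space of their own.\<close>

definition mean_quantile_cost :: "nat \<Rightarrow> (nat \<Rightarrow> real) measure \<Rightarrow> (real \<Rightarrow> real) \<Rightarrow> ennreal" where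
  "mean_quantile_cost n \<mu> f = (\<integral>\<^sup>+x. quantile_cost (step_quantile n x) f \<partial>\<mu>)"

lemma measurable_quantile_cost:
  assumes n: "n \<ge> 1" and Z: "\<And>i. i < n \<Longrightarrow> (\<lambda>\<omega>. Z \<omega> i) \<in> borel_measurable P"
    and f: "f \<in> borel_measurable unit_uniform"
  shows "(\<lambda>\<omega>. quantile_cost (step_quantile n (Z \<omega>)) f) \<in> borel_measurable P"
proof -
  have "(\<lambda>p. ennreal ((step_quantile n (Z (fst p)) (snd p) - f (snd p))\<^sup>2)) \<in> borel_measurable (P \<Otimes>\<^sub>M unit_uniform)"
    using measurable_step_quantile[OF n Z] measurable_compose[OF measurable_snd f]
    by (intro measurable_compose[OF _ measurable_ennreal] borel_measurable_power borel_measurable_diff)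
      (auto simp: split_beta')
  then show ?thesis
    unfolding quantile_cost_def
    by (intro unit_uniform.borel_measurable_nn_integral) (simp add: split_beta')
qed

lemma mean_quantile_cost_config_law:
  assumes n: "n \<ge> 1" and X: "\<And>i. i < n \<Longrightarrow> X i t \<in> borel_measurable M"
    and f: "f \<in> borel_measurable unit_uniform"
  shows "mean_quantile_cost n (config_law M n X t) f
    = (\<integral>\<^sup>+\<omega>. quantile_cost (step_quantile n (\<lambda>i. X i t \<omega>)) f \<partial>M)"
proof -
  \<comment> \<open>\<open>config_law\<close> cuts configurations off outside \<open>{..<n}\<close>;
    for \<open>u\<close> in the open unit interval only indices below \<open>n\<close> are
    read.\<close>
  have "quantile_cost (step_quantile n (\<lambda>i\<in>{..<n}. X i t \<omega>)) f
      = quantile_cost (step_quantile n (\<lambda>i. X i t \<omega>)) f" for \<omega>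
    unfolding quantile_cost_def step_quantile_def
    using nat_floor_less[OF _ _ n] by (intro nn_integral_cong) auto
  then show ?thesis
    unfolding mean_quantile_cost_def config_law_def
    using measurable_quantile_cost[OF n measurable_config_coordinate f]
    by (subst nn_integral_distr[OF measurable_config[of n X t M, OF X]]) auto
qed

text \<open>Both bounds apply the triangle inequality pointwise under the coupling and integrate.
  The first changes the law together with its target function. The second compares two deterministic
  functions by passing through the two coupled random configurations.\<close>

lemma config_close_mean_quantile_cost:
  assumes n: "n \<ge> 1" and c: "0 \<le> c" and close: "config_close n c \<mu> \<nu>"
    and \<mu>: "sets \<mu> = sets (config_space n)" and \<nu>: "sets \<nu> = sets (config_space n)"
    and f: "f \<in> borel_measurable unit_uniform" and g: "g \<in> borel_measurable unit_uniform"
  shows "mean_quantile_cost n \<mu> f \<le> 3 * (ennreal c + mean_quantile_cost n \<nu> g + quantile_cost g f)"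
    and "quantile_cost f g \<le> 3 * (mean_quantile_cost n \<mu> f + ennreal c + mean_quantile_cost n \<nu> g)"
proof -
  obtain \<pi> where "prob_space \<pi>" and sets: "sets \<pi> = sets (\<mu> \<Otimes>\<^sub>M \<nu>)"
    and marg: "distr \<pi> \<mu> fst = \<mu>" "distr \<pi> \<nu> snd = \<nu>"
    and cost: "(\<integral>\<^sup>+p. ennreal (\<Sum>i<n. (fst p i - snd p i)\<^sup>2) \<partial>\<pi>) \<le> ennreal (real n * c)"
    using close by (auto simp: config_close_def couplings_def)
  interpret \<pi>: prob_space \<pi> by fact
  have sets': "sets \<pi> = sets (config_space n \<Otimes>\<^sub>M config_space n)"
    unfolding sets by (rule sets_pair_measure_cong[OF \<mu> \<nu>])
  have fst_m: "fst \<in> measurable \<pi> \<mu>" and snd_m: "snd \<in> measurable \<pi> \<nu>"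
    by (simp_all add: measurable_cong_sets[OF sets refl])
  let ?q = "step_quantile n"
  have q: "?q x \<in> borel_measurable unit_uniform" for x by (rule measurable_step_quantile_fixed[OF n])
  have m\<mu>: "(\<lambda>x. quantile_cost (?q x) h) \<in> borel_measurable \<mu>"
    and m\<nu>: "(\<lambda>x. quantile_cost (?q x) h) \<in> borel_measurable \<nu>" if "h \<in> borel_measurable unit_uniform" for h
    using measurable_quantile_cost[OF n measurable_config_coordinate that]
    by (simp_all add: measurable_cong_sets[OF \<mu> refl] measurable_cong_sets[OF \<nu> refl])
  have E_fst: "(\<integral>\<^sup>+p. quantile_cost (?q (fst p)) h \<partial>\<pi>) = mean_quantile_cost n \<mu> h"
    and m_fst: "(\<lambda>p. quantile_cost (?q (fst p)) h) \<in> borel_measurable \<pi>"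
    if "h \<in> borel_measurable unit_uniform" for h
  proof -
    have "(\<integral>\<^sup>+x. quantile_cost (?q x) h \<partial>distr \<pi> \<mu> fst) = (\<integral>\<^sup>+p. quantile_cost (?q (fst p)) h \<partial>\<pi>)"
      by (rule nn_integral_distr[OF fst_m]) (simp add: m\<mu> that)
    then show "(\<integral>\<^sup>+p. quantile_cost (?q (fst p)) h \<partial>\<pi>) = mean_quantile_cost n \<mu> h"
      by (simp only: mean_quantile_cost_def marg)
    show "(\<lambda>p. quantile_cost (?q (fst p)) h) \<in> borel_measurable \<pi>"
      by (rule measurable_compose[OF fst_m m\<mu>[OF that]])
  qed
  have E_snd: "(\<integral>\<^sup>+p. quantile_cost (?q (snd p)) h \<partial>\<pi>) = mean_quantile_cost n \<nu> h"
    and m_snd: "(\<lambda>p. quantile_cost (?q (snd p)) h) \<in> borel_measurable \<pi>"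
    if "h \<in> borel_measurable unit_uniform" for h
  proof -
    have "(\<integral>\<^sup>+x. quantile_cost (?q x) h \<partial>distr \<pi> \<nu> snd) = (\<integral>\<^sup>+p. quantile_cost (?q (snd p)) h \<partial>\<pi>)"
      by (rule nn_integral_distr[OF snd_m]) (simp add: m\<nu> that)
    then show "(\<integral>\<^sup>+p. quantile_cost (?q (snd p)) h \<partial>\<pi>) = mean_quantile_cost n \<nu> h"
      by (simp only: mean_quantile_cost_def marg)
    show "(\<lambda>p. quantile_cost (?q (snd p)) h) \<in> borel_measurable \<pi>"
      by (rule measurable_compose[OF snd_m m\<nu>[OF that]])
  qed
  have sq_m: "(\<lambda>p. \<Sum>i<n. (fst p i - snd p i)\<^sup>2) \<in> borel_measurable \<pi>"
    using measurable_config_sqdist[of n] by (simp add: measurable_cong_sets[OF sets' refl])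
  \<comment> \<open>Both step functions use the same cells, so particles are matched index by index,
    and the average over cells turns the cost \<open>real n * c\<close> into
    \<open>c\<close>.\<close>
  have pair: "quantile_cost (?q (fst p)) (?q (snd p)) = ennreal (1 / n) * ennreal (\<Sum>i<n. (fst p i - snd p i)\<^sup>2)" for p
    by (simp add: quantile_cost_step_quantile[OF n] ennreal_mult' sum_nonneg flip: ennreal_mult')
  have m_pair: "(\<lambda>p. quantile_cost (?q (fst p)) (?q (snd p))) \<in> borel_measurable \<pi>"
    unfolding pair by (rule borel_measurable_times_ennreal) (use sq_m in auto)
  have "(\<integral>\<^sup>+p. quantile_cost (?q (fst p)) (?q (snd p)) \<partial>\<pi>)
      = ennreal (1 / n) * (\<integral>\<^sup>+p. ennreal (\<Sum>i<n. (fst p i - snd p i)\<^sup>2) \<partial>\<pi>)"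
    unfolding pair using sq_m by (intro nn_integral_cmult) auto
  also have "\<dots> \<le> ennreal (1 / n) * ennreal (real n * c)" using cost by (intro mult_left_mono) auto
  also have "\<dots> = ennreal c" using n c by (simp flip: ennreal_mult')
  finally have E_pair: "(\<integral>\<^sup>+p. quantile_cost (?q (fst p)) (?q (snd p)) \<partial>\<pi>) \<le> ennreal c" .
  have "mean_quantile_cost n \<mu> f = (\<integral>\<^sup>+p. quantile_cost (?q (fst p)) f \<partial>\<pi>)"
    by (simp add: E_fst[OF f])
  also have "\<dots> \<le> (\<integral>\<^sup>+p. 3 * (quantile_cost (?q (fst p)) (?q (snd p)) + quantile_cost (?q (snd p)) g
      + quantile_cost g f) \<partial>\<pi>)"
    by (intro nn_integral_mono quantile_cost_triangle q f g)
  also have "\<dots> = 3 * ((\<integral>\<^sup>+p. quantile_cost (?q (fst p)) (?q (snd p)) \<partial>\<pi>)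
      + mean_quantile_cost n \<nu> g + quantile_cost g f)"
    using m_pair m_snd[OF g] by (simp add: nn_integral_cmult nn_integral_add E_snd[OF g] \<pi>.emeasure_space_1)
  also have "\<dots> \<le> 3 * (ennreal c + mean_quantile_cost n \<nu> g + quantile_cost g f)"
    using E_pair by (intro mult_left_mono add_mono) auto
  finally show "mean_quantile_cost n \<mu> f \<le> 3 * (ennreal c + mean_quantile_cost n \<nu> g + quantile_cost g f)" .
  \<comment> \<open>The coupling has mass 1, so the deterministic cost equals its average.\<close>
  have "quantile_cost f g = (\<integral>\<^sup>+p. quantile_cost f g \<partial>\<pi>)" by (simp add: \<pi>.emeasure_space_1)
  also have "\<dots> \<le> (\<integral>\<^sup>+p. 3 * (quantile_cost (?q (fst p)) f + quantile_cost (?q (fst p)) (?q (snd p))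
      + quantile_cost (?q (snd p)) g) \<partial>\<pi>)"
    using quantile_cost_triangle[OF f q q g] by (intro nn_integral_mono) (simp add: quantile_cost_commute[of f])
  also have "\<dots> = 3 * (mean_quantile_cost n \<mu> f + (\<integral>\<^sup>+p. quantile_cost (?q (fst p)) (?q (snd p)) \<partial>\<pi>)
      + mean_quantile_cost n \<nu> g)"
    using m_pair m_snd[OF g] m_fst[OF f]
    by (simp add: nn_integral_cmult nn_integral_add E_snd[OF g] E_fst[OF f])
  also have "\<dots> \<le> 3 * (mean_quantile_cost n \<mu> f + ennreal c + mean_quantile_cost n \<nu> g)"
    using E_pair by (intro mult_left_mono add_mono) auto
  finally show "quantile_cost f g \<le> 3 * (mean_quantile_cost n \<mu> f + ennreal c + mean_quantile_cost n \<nu> g)" .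
qed

section \<open>From single times to all times\<close>

text \<open>Time \<open>t\<close> is replaced by a nearby net time \<open>s\<close>, both for the
  particles and for the limit. The final \<open>N\<close> sees only the rates at the finitely many
  points of the net; the rate at \<open>t\<close> enters solely through an auxiliary particle
  number.\<close>

lemma mean_quantile_cost_uniform_in_time:
  fixes P :: "nat \<Rightarrow> real \<Rightarrow> (nat \<Rightarrow> real) measure" and r :: "real \<Rightarrow> real \<Rightarrow> real"
  assumes P: "\<And>n t. sets (P n t) = sets (config_space n)"
    and r: "\<And>t. t \<ge> 0 \<Longrightarrow> r t \<in> borel_measurable unit_uniform"
    and pointwise: "\<And>e t. 0 < e \<Longrightarrow> t \<ge> 0 \<Longrightarrow> \<exists>N. \<forall>n\<ge>N. mean_quantile_cost n (P n t) (r t) \<le> ennreal e"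
    and net: "\<And>c. 0 < c \<Longrightarrow> \<exists>S. finite S \<and> S \<subseteq> {0..} \<and>
      (\<forall>t\<ge>0. \<exists>s\<in>S. \<forall>n\<ge>1. config_close n c (P n t) (P n s))"
    and e: "0 < e"
  shows "\<exists>N. \<forall>t\<ge>0. \<forall>n\<ge>N. mean_quantile_cost n (P n t) (r t) \<le> ennreal e"
proof -
  \<comment> \<open>The limits at \<open>s\<close> and \<open>t\<close> differ by at most
    \<open>3 * (c + c + c) = 9 * c\<close>, and then the cost at \<open>t\<close> is at most
    \<open>3 * (c + c + 9 * c) = 33 * c\<close>.\<close>
  define c where "c = e / 33"
  have c: "0 < c" using e by (simp add: c_def)
  obtain S where S: "finite S" "S \<subseteq> {0..}"
    "\<And>t. t \<ge> 0 \<Longrightarrow> \<exists>s\<in>S. \<forall>n\<ge>1. config_close n c (P n t) (P n s)"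
    using net[OF c] by blast
  have "\<exists>N. \<forall>n\<ge>N. mean_quantile_cost n (P n t) (r t) \<le> ennreal c" if "t \<ge> 0" for t
    by (rule pointwise[OF c that])
  then obtain K where K: "\<And>t n. t \<ge> 0 \<Longrightarrow> n \<ge> K t \<Longrightarrow> mean_quantile_cost n (P n t) (r t) \<le> ennreal c"
    by metis
  \<comment> \<open>The sum dominates every \<open>K s\<close> with \<open>s\<close> in the net, and
    \<open>Suc\<close> ensures at least one particle.\<close>
  define N where "N = Suc (\<Sum>s\<in>S. K s)"
  have N: "K s \<le> N" if "s \<in> S" for s
    using member_le_sum[OF that, of K] S(1) by (simp add: N_def)
  have three: "3 * (ennreal x + ennreal y + ennreal z) = ennreal (3 * (x + y + z))"
    if "0 \<le> x" "0 \<le> y" "0 \<le> z" for x y z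
    using that by (simp only: ennreal_mult' ennreal_plus add_nonneg_nonneg) simp
  have "mean_quantile_cost n (P n t) (r t) \<le> ennreal e" if t: "t \<ge> 0" and n: "n \<ge> N" for t n
  proof -
    obtain s where s: "s \<in> S" "\<And>n. n \<ge> 1 \<Longrightarrow> config_close n c (P n t) (P n s)" using S(3)[OF t] by blast
    have s0: "s \<ge> 0" using s(1) S(2) by auto
    have n1: "n \<ge> 1" using n by (simp add: N_def)
    \<comment> \<open>Large enough for the rates at both \<open>s\<close> and \<open>t\<close>. It
      may depend on \<open>t\<close>, since it serves only to bound a cost between
      \<open>r t\<close> and \<open>r s\<close>, in which no particle number occurs.\<close>
    define m where "m = n + K t"
    have m: "m \<ge> 1" "m \<ge> K t" "m \<ge> K s" using n1 n N[OF s(1)] by (auto simp: m_def)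
    have "quantile_cost (r t) (r s) \<le> 3 * (mean_quantile_cost m (P m t) (r t) + ennreal c + mean_quantile_cost m (P m s) (r s))"
      using m c t s0 by (intro config_close_mean_quantile_cost s P r) auto
    also have "\<dots> \<le> 3 * (ennreal c + ennreal c + ennreal c)"
      using K[OF t m(2)] K[OF s0 m(3)] by (intro mult_left_mono add_mono) auto
    also have "\<dots> = ennreal (9 * c)" using three[of c c c] c by simp
    finally have D: "quantile_cost (r s) (r t) \<le> ennreal (9 * c)" by (subst quantile_cost_commute)
    have "mean_quantile_cost n (P n t) (r t) \<le> 3 * (ennreal c + mean_quantile_cost n (P n s) (r s) + quantile_cost (r s) (r t))"
      using n1 c t s0 by (intro config_close_mean_quantile_cost s P r) auto
    also have "\<dots> \<le> 3 * (ennreal c + ennreal c + ennreal (9 * c))"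
      using K[OF s0, of n] N[OF s(1)] n D by (intro mult_left_mono add_mono) auto
    also have "\<dots> = ennreal (33 * c)" using three[of c c "9 * c"] c by simp
    finally show ?thesis by (simp add: c_def)
  qed
  then show ?thesis by blast
qed

text \<open>Write \<open>t = h + s\<close> with \<open>s\<close> in the net. Late times use
  \<open>s = T\<close> with arbitrary \<open>h\<close>, where the decay beats the global bound
  \<open>b\<close>. Earlier times use the preceding grid point, where \<open>h\<close> is small and
  the contraction factor is at most 1.\<close>

lemma time_net:
  fixes P :: "nat \<Rightarrow> real \<Rightarrow> (nat \<Rightarrow> real) measure"
  assumes lam: "0 < lam" and b: "0 \<le> b"
    and contraction: "\<And>n h t. n \<ge> 1 \<Longrightarrow> h \<ge> 0 \<Longrightarrow> t \<ge> 0 \<Longrightarrow>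
      W2_config n (P n (h + t)) (P n t) \<le> ennreal (exp (- lam * t)) * W2_config n (P n h) (P n 0)"
    and bounded: "\<And>n h. n \<ge> 1 \<Longrightarrow> h \<ge> 0 \<Longrightarrow> W2_config n (P n h) (P n 0) \<le> ennreal (sqrt (real n * b))"
    and continuous: "\<And>c. 0 < c \<Longrightarrow> \<exists>\<delta>>0. \<forall>h. 0 \<le> h \<and> h < \<delta> \<longrightarrow> (\<forall>n\<ge>1.
      W2_config n (P n h) (P n 0) \<le> ennreal (sqrt (real n * c)))"
    and c: "0 < c"
  shows "\<exists>S. finite S \<and> S \<subseteq> {0..} \<and> (\<forall>t\<ge>0. \<exists>s\<in>S. \<forall>n\<ge>1. config_close n c (P n t) (P n s))"
proof -
  \<comment> \<open>The common factor \<open>sqrt (real n)\<close> drops out, which makes the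
    condition on \<open>s\<close> and \<open>d\<close> independent of \<open>n\<close>. It is strict
    in order to yield a coupling.\<close>
  have closeI: "config_close n c (P n (h + s)) (P n s)"
    if n: "n \<ge> 1" and "h \<ge> 0" "s \<ge> 0" and d: "W2_config n (P n h) (P n 0) \<le> ennreal (sqrt (real n * d))"
      "exp (- lam * s) * sqrt d < sqrt c" for n h s d
  proof -
    have "W2_config n (P n (h + s)) (P n s) \<le> ennreal (exp (- lam * s)) * W2_config n (P n h) (P n 0)"
      by (rule contraction) fact+
    also have "\<dots> \<le> ennreal (exp (- lam * s)) * ennreal (sqrt (real n * d))"
      using d(1) by (intro mult_left_mono) auto
    also have "\<dots> = ennreal (sqrt (real n) * (exp (- lam * s) * sqrt d))"
      by (simp add: real_sqrt_mult mult_ac flip: ennreal_mult')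
    also have "\<dots> < ennreal (sqrt (real n * c))"
      using n d(2) c unfolding real_sqrt_mult by (intro ennreal_lessI mult_strict_left_mono mult_pos_pos) auto
    finally show ?thesis using c by (intro config_close_if_W2) auto
  qed
  \<comment> \<open>\<open>T\<close> solves \<open>exp (- lam * T) = 1 / z\<close>. Since
    \<open>sqrt c * z = sqrt b + sqrt c\<close>, the summand 1 gives strict inequality, and it also
    ensures \<open>z \<ge> 1\<close>, so that \<open>T\<close> is nonnegative.\<close>
  define z where "z = sqrt b / sqrt c + 1"
  define T where "T = ln z / lam"
  have z: "1 \<le> z" using b c by (simp add: z_def)
  have "lam * T = ln z" using lam by (simp add: T_def)
  then have T: "0 \<le> T" "exp (- lam * T) = 1 / z"
    using z lam by (simp_all add: T_def exp_minus inverse_eq_divide)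
  have "sqrt b < sqrt c * z" using c by (simp add: z_def field_simps)
  then have T_small: "exp (- lam * T) * sqrt b < sqrt c"
    unfolding T(2) using z by (simp add: field_simps)
  \<comment> \<open>Half of \<open>c\<close> leaves room for the strict inequality
    \<open>sqrt (c / 2) < sqrt c\<close>.\<close>
  obtain \<delta> where \<delta>: "0 < \<delta>" "\<And>h n. 0 \<le> h \<Longrightarrow> h < \<delta> \<Longrightarrow> n \<ge> 1 \<Longrightarrow>
      W2_config n (P n h) (P n 0) \<le> ennreal (sqrt (real n * (c / 2)))"
    using continuous[of "c / 2"] c by auto
  define \<tau> where "\<tau> = \<delta> / 2"
  have \<tau>: "0 < \<tau>" "\<tau> < \<delta>" using \<delta>(1) by (auto simp: \<tau>_def)
  define S where "S = insert T ((\<lambda>k. real k * \<tau>) ` {..nat \<lfloor>T / \<tau>\<rfloor>})"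
  have "\<exists>s\<in>S. \<forall>n\<ge>1. config_close n c (P n t) (P n s)" if t: "t \<ge> 0" for t
  proof (cases "t < T")
    case False
    have "config_close n c (P n (t - T + T)) (P n T)" if "n \<ge> 1" for n
      using that False T by (intro closeI[OF _ _ _ bounded T_small]) auto
    then show ?thesis by (intro bexI[of _ T]) (auto simp: S_def)
  next
    case True
    define k where "k = nat \<lfloor>t / \<tau>\<rfloor>"
    define h where "h = t - real k * \<tau>"
    have "k \<le> nat \<lfloor>T / \<tau>\<rfloor>"
      unfolding k_def using True \<tau> by (intro nat_mono floor_mono divide_right_mono) auto
    then have kS: "real k * \<tau> \<in> S" by (auto simp: S_def)
    have "0 \<le> t / \<tau>" using t \<tau> by simp
    then have "real k \<le> t / \<tau>" "t / \<tau> < real k + 1" unfolding k_def by linarith+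
    then have h: "0 \<le> h" "h < \<delta>"
      using \<tau> by (auto simp: h_def field_simps)
    have k0: "0 \<le> real k * \<tau>" using \<tau> by simp
    have "exp (- lam * (real k * \<tau>)) * sqrt (c / 2) \<le> sqrt (c / 2)"
      using lam k0 c by (intro mult_left_le_one_le) auto
    also have "\<dots> < sqrt c" using c by simp
    finally have "config_close n c (P n (h + real k * \<tau>)) (P n (real k * \<tau>))" if "n \<ge> 1" for n
      using that h k0 by (intro closeI[OF _ _ _ \<delta>(2)]) auto
    then show ?thesis using kS by (intro bexI[of _ "real k * \<tau>"]) (auto simp: h_def)
  qed
  moreover have "finite S" "S \<subseteq> {0..}" using T \<tau> by (auto simp: S_def)
  ultimately show ?thesis by blast
qed

section \<open>Uniform propagation of chaos\<close>

lemma strong_solutionD: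
  assumes "strong_solution M F0 N \<sigma> U V B X"
  shows "prob_space M"
    and "i < N \<Longrightarrow> 0 \<le> t \<Longrightarrow> X i t \<in> borel_measurable M"
    and "0 \<le> t \<Longrightarrow> AE \<omega> in M. mono_on {..<N} (\<lambda>i. X i t \<omega>)"
proof -
  have F0: "subalgebra M F0" and B: "driving_noise M F0 N B"
    and X: "\<And>i t. i < N \<Longrightarrow> 0 \<le> t \<Longrightarrow> X i t \<in> borel_measurable (noise_filtration M F0 N B t)"
    using assms by (simp_all add: strong_solution_def)
  have B_m: "B i r \<in> borel_measurable M" if "i < N" "0 \<le> r" for i r
    using B that by (simp add: driving_noise_def brownian_motion_def)
  show "prob_space M" using assms by (simp add: strong_solution_def)
  show "X i t \<in> borel_measurable M" if "i < N" "0 \<le> t"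
  proof (rule measurable_from_sets_subset[OF X[OF that]])
    show "sets (noise_filtration M F0 N B t) \<subseteq> sets M"
      using F0 by (intro sets_noise_filtration_subset B_m)
        (simp_all add: subalgebra_def null_sets_def subset_eq)
  qed simp
  show "AE \<omega> in M. mono_on {..<N} (\<lambda>i. X i t \<omega>)" if "0 \<le> t"
    using assms[unfolded strong_solution_def, THEN conjunct2, THEN conjunct2, THEN conjunct2,
      THEN conjunct2, THEN conjunct2]
  proof (rule AE_mp, intro AE_I2 impI, elim conjE)
    fix \<omega> assume "\<forall>t\<ge>0. mono_on {..<N} (\<lambda>i. X i t \<omega>)"
    then show "mono_on {..<N} (\<lambda>i. X i t \<omega>)" using that by blast
  qed
qed

text \<open>Turns the fourth moment bound into a bound on the mean squared displacement at all
  times, which supplies the constant \<open>4 + 4 * C\<^sub>0\<close> for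
  \<open>time_net\<close>.\<close>

lemma diff_power2_le_fourth_powers:
  fixes a b :: real
  shows "(a - b)\<^sup>2 \<le> 4 + 2 * \<bar>a\<bar> ^ 4 + 2 * \<bar>b\<bar> ^ 4"
proof -
  have *: "x\<^sup>2 \<le> 1 + \<bar>x\<bar> ^ 4" for x :: real
  proof -
    have "0 \<le> (x\<^sup>2 - 1)\<^sup>2 + 1 + x ^ 4" by simp
    then show ?thesis by (simp add: power2_eq_square power4_eq_xxxx algebra_simps)
  qed
  have "(a - b)\<^sup>2 \<le> 2 * a\<^sup>2 + 2 * b\<^sup>2"
    using zero_le_power2[of "a + b"] by (simp add: power2_eq_square algebra_simps)
  then show ?thesis using *[of a] *[of b] by linarith
qed

text \<open>Passes from displacements averaged over particles to the unnormalised Euclidean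
  distance, at the price of the factor \<open>real n\<close> under the root.\<close>

lemma W2_config_config_law_le_sqrt:
  assumes X: "strong_solution M F0 n \<sigma> U V B X" and n: "n \<ge> 1" and s: "0 \<le> s" and d: "0 \<le> d"
    and bound: "(\<integral>\<^sup>+\<omega>. ennreal ((1 / real n) * (\<Sum>i<n. \<bar>X i s \<omega> - X i 0 \<omega>\<bar>\<^sup>2)) \<partial>M) \<le> ennreal d"
  shows "W2_config n (config_law M n X s) (config_law M n X 0) \<le> ennreal (sqrt (real n * d))"
proof -
  note Xm = strong_solutionD(2)[OF X]
  have sq_m: "(\<lambda>\<omega>. \<Sum>i<n. (X i s \<omega> - X i 0 \<omega>)\<^sup>2) \<in> borel_measurable M"
    using s by (intro borel_measurable_sum borel_measurable_power borel_measurable_diff Xm) auto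
  have "(\<integral>\<^sup>+\<omega>. ennreal (\<Sum>i<n. (X i s \<omega> - X i 0 \<omega>)\<^sup>2) \<partial>M)
      = (\<integral>\<^sup>+\<omega>. ennreal (real n) * ennreal ((1 / real n) * (\<Sum>i<n. (X i s \<omega> - X i 0 \<omega>)\<^sup>2)) \<partial>M)"
    using n by (intro nn_integral_cong) (simp add: sum_nonneg flip: ennreal_mult')
  also have "\<dots> = ennreal (real n) * (\<integral>\<^sup>+\<omega>. ennreal ((1 / real n) * (\<Sum>i<n. (X i s \<omega> - X i 0 \<omega>)\<^sup>2)) \<partial>M)"
    using sq_m by (intro nn_integral_cmult) auto
  also have "\<dots> \<le> ennreal (real n) * ennreal d"
    using bound by (intro mult_left_mono) (simp_all add: power2_abs)
  also have "\<dots> = ennreal (real n * d)" by (simp add: ennreal_mult')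
  finally have "ennreal_sqrt (\<integral>\<^sup>+\<omega>. ennreal (\<Sum>i<n. (X i s \<omega> - X i 0 \<omega>)\<^sup>2) \<partial>M) \<le> ennreal (sqrt (real n * d))"
    using d by (intro ennreal_sqrt_leI) auto
  moreover have "W2_config n (config_law M n X s) (config_law M n X 0)
      \<le> ennreal_sqrt (\<integral>\<^sup>+\<omega>. ennreal (\<Sum>i<n. (X i s \<omega> - X i 0 \<omega>)\<^sup>2) \<partial>M)"
    using s by (intro W2_config_config_law_le strong_solutionD(1)[OF X] Xm) auto
  ultimately show ?thesis by (rule order_trans[rotated])
qed

theorem theorem6:
  fixes U V :: "real \<Rightarrow> real" and \<sigma> :: "nat \<Rightarrow> real"
    and M F0 :: "nat \<Rightarrow> 'a measure"
    and B X :: "nat \<Rightarrow> nat \<Rightarrow> real \<Rightarrow> 'a \<Rightarrow> real"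
    and \<mu> :: "nat \<Rightarrow> real \<Rightarrow> 'a \<Rightarrow> real measure"
    and \<rho> :: "real \<Rightarrow> real measure"
    and C\<^sub>0 lam :: real
  assumes U: "\<And>x. U differentiable (at x)"
    and V: "\<And>x. x \<noteq> 0 \<Longrightarrow> V differentiable (at x)"
    and sigma: "\<And>N. N \<ge> 1 \<Longrightarrow> \<sigma> N \<ge> 0"
    and solution: "\<And>N. N \<ge> 1 \<Longrightarrow> strong_solution (M N) (F0 N) N (\<sigma> N) U V (B N) (X N)"
    and mu: "\<And>N t \<omega>. \<mu> N t \<omega> = empirical_measure N (\<lambda>i. X N i t \<omega>)"
    and rho: "\<And>t. t \<ge> 0 \<Longrightarrow> prob_space (\<rho> t) \<and> sets (\<rho> t) = sets borel"
    and chaos_0: "W2_converges_in_prob M (\<lambda>N. \<mu> N 0) (\<rho> 0)"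
    and chaos: "\<And>t. t \<ge> 0 \<Longrightarrow> weakly_converges_in_prob M (\<lambda>N. \<mu> N t) (\<rho> t)"
    and C0: "C\<^sub>0 \<ge> 0"
    and moments: "\<And>N t. N \<ge> 1 \<Longrightarrow> t \<ge> 0 \<Longrightarrow>
      (\<integral>\<^sup>+ \<omega>. ennreal ((1 / real N) * (\<Sum>i<N. \<bar>X N i t \<omega>\<bar> ^ 4)) \<partial>M N) \<le> ennreal C\<^sub>0"
    and lam: "lam > 0"
    and contraction: "\<And>N (M\<^sub>1 :: 'a measure) F\<^sub>1 B\<^sub>1 X\<^sub>1 (M\<^sub>2 :: 'a measure) F\<^sub>2 B\<^sub>2 X\<^sub>2 t.
      N \<ge> 1 \<Longrightarrow>
      strong_solution M\<^sub>1 F\<^sub>1 N (\<sigma> N) U V B\<^sub>1 X\<^sub>1 \<Longrightarrow>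
      strong_solution M\<^sub>2 F\<^sub>2 N (\<sigma> N) U V B\<^sub>2 X\<^sub>2 \<Longrightarrow> t \<ge> 0 \<Longrightarrow>
      W2_config N (config_law M\<^sub>1 N X\<^sub>1 t) (config_law M\<^sub>2 N X\<^sub>2 t)
        \<le> ennreal (exp (- lam * t)) * W2_config N (config_law M\<^sub>1 N X\<^sub>1 0) (config_law M\<^sub>2 N X\<^sub>2 0)"
    and continuity_0: "\<And>\<epsilon>. \<epsilon> > 0 \<Longrightarrow> \<exists>\<delta>>0. \<forall>t. 0 \<le> t \<and> t < \<delta> \<longrightarrow> (\<forall>N\<ge>1.
      (\<integral>\<^sup>+ \<omega>. ennreal ((1 / real N) * (\<Sum>i<N. \<bar>X N i t \<omega> - X N i 0 \<omega>\<bar>\<^sup>2)) \<partial>M N) \<le> ennreal \<epsilon>)"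
  shows "\<forall>\<epsilon>::real. \<epsilon> > 0 \<longrightarrow> (\<exists>N::nat. \<forall>t\<ge>0. \<forall>n\<ge>N.
      (\<integral>\<^sup>+ \<omega>. W2_line (\<mu> n t \<omega>) (\<rho> t) \<partial>M n) < ennreal \<epsilon>)"
proof (intro allI impI)
  fix \<epsilon> :: real assume \<epsilon>: "0 < \<epsilon>"
  note prob = strong_solutionD(1)[OF solution]
    and Xm = strong_solutionD(2)[OF solution]
    and ordered = strong_solutionD(3)[OF solution]
  define P where "P n t = config_law (M n) n (X n) t" for n t
  define r where "r t = quantile (\<rho> t)" for t
  have P_sets: "sets (P n t) = sets (config_space n)" for n t
    by (simp add: P_def config_law_def)
  have r_m: "r t \<in> borel_measurable unit_uniform" if "t \<ge> 0" for t
    unfolding r_def using rho[OF that] by (intro measurable_quantile) auto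
  have pointwise: "\<exists>N. \<forall>n\<ge>N. mean_quantile_cost n (P n t) (r t) \<le> ennreal e" if e: "0 < e" and t: "t \<ge> 0" for e t
  proof -
    interpret weak_chaos M "\<lambda>n i. X n i t" "\<rho> t" C\<^sub>0
    proof (rule weak_chaos.intro)
      have "\<mu> n t = (\<lambda>\<omega>. empirical_measure n (\<lambda>i. X n i t \<omega>))" for n
        by (rule ext) (rule mu)
      then show "weakly_converges_in_prob M (\<lambda>n \<omega>. empirical_measure n (\<lambda>i. X n i t \<omega>)) (\<rho> t)"
        using chaos[OF t] by simp
      show "prob_space (\<rho> t)" "sets (\<rho> t) = sets borel" using rho[OF t] by auto
    qed (rule prob Xm ordered C0 moments, ((assumption | rule t)+)?)+
    obtain N where N: "\<And>n. n \<ge> N \<Longrightarrow>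
        (\<integral>\<^sup>+\<omega>. quantile_cost (step_quantile n (\<lambda>i. X n i t \<omega>)) (quantile (\<rho> t)) \<partial>M n) \<le> ennreal e"
      using expected_quantile_cost_small[OF e] by blast
    have "mean_quantile_cost n (P n t) (r t) \<le> ennreal e" if "n \<ge> max 1 N" for n
      unfolding P_def using that N[of n] Xm[OF _ _ t, of n] r_m[OF t]
      by (subst mean_quantile_cost_config_law) (auto simp: r_def)
    then show ?thesis by blast
  qed
  have net: "\<exists>S. finite S \<and> S \<subseteq> {0..} \<and> (\<forall>t\<ge>0. \<exists>s\<in>S. \<forall>n\<ge>1. config_close n c (P n t) (P n s))"
    if c: "0 < c" for c
  proof (rule time_net[OF lam _ _ _ _ c])
    show "0 \<le> 4 + 4 * C\<^sub>0" using C0 by simp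
    \<comment> \<open>The contraction compares the solution restarted at \<open>h\<close> with the
      original one. The restarted solution has initial law \<open>P n h\<close> and at time
      \<open>t\<close> the law \<open>P n (h + t)\<close>.\<close>
    show "W2_config n (P n (h + t)) (P n t) \<le> ennreal (exp (- lam * t)) * W2_config n (P n h) (P n 0)"
      if "n \<ge> 1" "h \<ge> 0" "t \<ge> 0" for n h t
      using contraction[OF that(1) strong_solution_restart[OF solution[OF that(1)] that(2)] solution[OF that(1)] that(3)]
      by (simp add: P_def config_law_def)
    show "W2_config n (P n h) (P n 0) \<le> ennreal (sqrt (real n * (4 + 4 * C\<^sub>0)))" if n: "n \<ge> 1" and h: "h \<ge> 0" for n h
      unfolding P_def
    proof (rule W2_config_config_law_le_sqrt[OF solution[OF n] n h])
      interpret prob_space "M n" by (rule prob[OF n])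
      let ?S = "\<lambda>t \<omega>. (1 / real n) * (\<Sum>i<n. \<bar>X n i t \<omega>\<bar> ^ 4)"
      have S_m: "?S t \<in> borel_measurable (M n)" if "0 \<le> t" for t
        using that n by (intro borel_measurable_times borel_measurable_sum borel_measurable_power borel_measurable_abs Xm) auto
      have "(\<integral>\<^sup>+\<omega>. ennreal ((1 / real n) * (\<Sum>i<n. \<bar>X n i h \<omega> - X n i 0 \<omega>\<bar>\<^sup>2)) \<partial>M n)
          \<le> (\<integral>\<^sup>+\<omega>. ennreal 4 + (ennreal 2 * ennreal (?S h \<omega>) + ennreal 2 * ennreal (?S 0 \<omega>)) \<partial>M n)"
      proof (rule nn_integral_mono)
        fix \<omega>
        have "(1 / real n) * (\<Sum>i<n. \<bar>X n i h \<omega> - X n i 0 \<omega>\<bar>\<^sup>2)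
            \<le> (1 / real n) * (\<Sum>i<n. 4 + 2 * \<bar>X n i h \<omega>\<bar> ^ 4 + 2 * \<bar>X n i 0 \<omega>\<bar> ^ 4)"
          unfolding power2_abs by (intro mult_left_mono sum_mono diff_power2_le_fourth_powers) auto
        also have "\<dots> = 4 + (2 * ?S h \<omega> + 2 * ?S 0 \<omega>)"
          using n by (simp add: sum.distrib sum_distrib_left[symmetric] field_simps)
        finally have "ennreal ((1 / real n) * (\<Sum>i<n. \<bar>X n i h \<omega> - X n i 0 \<omega>\<bar>\<^sup>2))
            \<le> ennreal (4 + (2 * ?S h \<omega> + 2 * ?S 0 \<omega>))" by (rule ennreal_leI)
        also have "\<dots> = ennreal 4 + (ennreal 2 * ennreal (?S h \<omega>) + ennreal 2 * ennreal (?S 0 \<omega>))"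
        proof -
          have "0 \<le> ?S t \<omega>" for t by (simp add: sum_nonneg)
          then show ?thesis by (simp only: ennreal_plus ennreal_mult add_nonneg_nonneg mult_nonneg_nonneg zero_le_numeral)
        qed
        finally show "ennreal ((1 / real n) * (\<Sum>i<n. \<bar>X n i h \<omega> - X n i 0 \<omega>\<bar>\<^sup>2))
            \<le> ennreal 4 + (ennreal 2 * ennreal (?S h \<omega>) + ennreal 2 * ennreal (?S 0 \<omega>))" .
      qed
      also have "\<dots> = ennreal 4 + (ennreal 2 * (\<integral>\<^sup>+\<omega>. ennreal (?S h \<omega>) \<partial>M n) + ennreal 2 * (\<integral>\<^sup>+\<omega>. ennreal (?S 0 \<omega>) \<partial>M n))"
        using S_m[OF h] S_m[of 0] by (simp add: nn_integral_add nn_integral_cmult emeasure_space_1)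
      also have "\<dots> \<le> ennreal 4 + (ennreal 2 * ennreal C\<^sub>0 + ennreal 2 * ennreal C\<^sub>0)"
        using moments[OF n h] moments[OF n, of 0] by (intro add_mono mult_left_mono) auto
      also have "\<dots> = ennreal (4 + (2 * C\<^sub>0 + 2 * C\<^sub>0))"
        using C0 by (simp only: ennreal_plus ennreal_mult add_nonneg_nonneg mult_nonneg_nonneg zero_le_numeral)
      finally show "(\<integral>\<^sup>+\<omega>. ennreal ((1 / real n) * (\<Sum>i<n. \<bar>X n i h \<omega> - X n i 0 \<omega>\<bar>\<^sup>2)) \<partial>M n)
          \<le> ennreal (4 + 4 * C\<^sub>0)" by (simp add: algebra_simps)
    qed (use C0 in simp)
    show "\<exists>\<delta>>0. \<forall>h. 0 \<le> h \<and> h < \<delta> \<longrightarrow> (\<forall>n\<ge>1. W2_config n (P n h) (P n 0) \<le> ennreal (sqrt (real n * d)))"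
      if d: "0 < d" for d
    proof -
      obtain \<delta> where \<delta>: "\<delta> > 0" "\<And>t N. 0 \<le> t \<Longrightarrow> t < \<delta> \<Longrightarrow> N \<ge> 1 \<Longrightarrow>
          (\<integral>\<^sup>+ \<omega>. ennreal ((1 / real N) * (\<Sum>i<N. \<bar>X N i t \<omega> - X N i 0 \<omega>\<bar>\<^sup>2)) \<partial>M N) \<le> ennreal d"
        using continuity_0[OF d] by blast
      have "W2_config n (P n h) (P n 0) \<le> ennreal (sqrt (real n * d))" if "0 \<le> h" "h < \<delta>" "n \<ge> 1" for n h
        unfolding P_def using that d \<delta>(2)
        by (intro W2_config_config_law_le_sqrt[OF solution]) auto
      then show ?thesis using \<delta>(1) by blast
    qed
  qed
  \<comment> \<open>With expected cost at most \<open>\<kappa>\<^sup>2\<close>, the affine bound on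
    the root gives \<open>\<kappa> + \<kappa>\<^sup>2 / \<kappa> = 2 * \<kappa>\<close>, strictly
    below \<open>\<epsilon>\<close>.\<close>
  define \<kappa> where "\<kappa> = \<epsilon> / 3"
  have \<kappa>: "0 < \<kappa>" using \<epsilon> by (simp add: \<kappa>_def)
  obtain N where N: "\<And>t n. t \<ge> 0 \<Longrightarrow> n \<ge> N \<Longrightarrow> mean_quantile_cost n (P n t) (r t) \<le> ennreal (\<kappa>\<^sup>2)"
    using mean_quantile_cost_uniform_in_time[of P r "\<kappa>\<^sup>2", OF P_sets r_m pointwise net] \<kappa> by auto
  have "(\<integral>\<^sup>+ \<omega>. W2_line (\<mu> n t \<omega>) (\<rho> t) \<partial>M n) < ennreal \<epsilon>" if t: "t \<ge> 0" and "n \<ge> max 1 N" for t n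
  proof -
    have n: "n \<ge> 1" "n \<ge> N" using that by auto
    interpret prob_space "M n" by (rule prob[OF n(1)])
    let ?q = "\<lambda>\<omega>. step_quantile n (\<lambda>i. X n i t \<omega>)"
    have cost_m: "(\<lambda>\<omega>. quantile_cost (?q \<omega>) (r t)) \<in> borel_measurable (M n)"
      using n t by (intro measurable_quantile_cost r_m Xm) auto
    \<comment> \<open>The random distance is replaced at once by a measurable majorant that is
      affine in the cost, so its integral splits.\<close>
    have "(\<integral>\<^sup>+ \<omega>. W2_line (\<mu> n t \<omega>) (\<rho> t) \<partial>M n) \<le> (\<integral>\<^sup>+ \<omega>. ennreal \<kappa> + ennreal (1 / \<kappa>) * quantile_cost (?q \<omega>) (r t) \<partial>M n)"
    proof (rule nn_integral_mono)
      fix \<omega>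
      have "W2_line (\<mu> n t \<omega>) (\<rho> t) \<le> ennreal_sqrt (quantile_cost (?q \<omega>) (r t))"
        using W2_line_le_quantile_cost[OF measurable_step_quantile_fixed[OF n(1)] r_m[OF t]]
          distr_quantile[of "\<rho> t"] rho[OF t]
        by (simp add: distr_step_quantile[OF n(1)] mu r_def)
      also have "\<dots> \<le> ennreal \<kappa> + ennreal (1 / \<kappa>) * quantile_cost (?q \<omega>) (r t)"
        by (rule ennreal_sqrt_le[OF \<kappa>])
      finally show "W2_line (\<mu> n t \<omega>) (\<rho> t) \<le> ennreal \<kappa> + ennreal (1 / \<kappa>) * quantile_cost (?q \<omega>) (r t)" .
    qed
    also have "\<dots> = ennreal \<kappa> + ennreal (1 / \<kappa>) * mean_quantile_cost n (P n t) (r t)"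
      unfolding P_def using cost_m Xm[OF n(1) _ t] r_m[OF t]
      by (subst mean_quantile_cost_config_law[OF n(1)])
        (simp_all add: nn_integral_add nn_integral_cmult emeasure_space_1)
    also have "\<dots> \<le> ennreal \<kappa> + ennreal (1 / \<kappa>) * ennreal (\<kappa>\<^sup>2)"
      using N[OF t n(2)] by (intro add_mono mult_left_mono) auto
    also have "\<dots> = ennreal (2 * \<kappa>)"
      using \<kappa> by (simp add: power2_eq_square flip: ennreal_mult' ennreal_plus)
    also have "\<dots> < ennreal \<epsilon>" using \<epsilon> by (intro ennreal_lessI) (auto simp: \<kappa>_def)
    finally show ?thesis .
  qed
  then show "\<exists>N. \<forall>t\<ge>0. \<forall>n\<ge>N. (\<integral>\<^sup>+ \<omega>. W2_line (\<mu> n t \<omega>) (\<rho> t) \<partial>M n) < ennreal \<epsilon>" by blast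
qed

end
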